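(* (1) There is a constant $c>0$ such that for all integers $m\ge 3$ and $r\ge 3$, $\mathrm{ER}(m,3,r)\le c\cdot m\cdot \frac{r^3}{\log r}$. (2) There is a constant $c>0$ such that for all integers $\ell\ge 3$ and $r\ge 3$, $\mathrm{ER}(3,\ell,r)\le \left(\frac{c\, r^3}{\log r}\right)^{\ell-2}$. (3) There is a constant $c>0$ such that for every integer $r\ge 3$, $\mathrm{ER}(4,4,r)\le \frac{c\, r^7}{(\log r)^2}$.
   Context: An edge-coloring of $K_n$ is any map $\chi:E(K_n)\to\omega$ (arbitrarily many colors allowed). A clique is monochromatic if all its edges have the same color, and rainbow if all its edges have pairwise distinct colors. A coloring of a clique $K_s$ is lexical if there is an ordering $v_1,\dots,v_s$ of its vertices such that for $i<j$ and $i'<j'$, $\chi(v_iv_j)=\chi(v_{i'}v_{j'})$ if and only if $i=i'$ (two edges have the same color if and only if they have the same lower endpoint). $\mathrm{ER}(m,\ell,r)$ is the minimum $n$ such that every edge-coloring $\chi:E(K_n)\to\omega$ contains a monochromatic $K_m$, a lexical $K_\ell$, or a rainbow $K_r$. *)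

theory Defs
  imports Complex_Main "HOL-Library.Ramsey"
begin

text \<open>
  The complete graph on a vertex set \<open>S\<close> has edge set \<open>[S]\<^bsup>2\<^esup>\<close> (the two-element subsets of \<open>S\<close>).
  An edge-coloring of it is a function \<open>\<chi> :: 'a set \<Rightarrow> nat\<close>, of which only the values on
  \<open>[S]\<^bsup>2\<^esup>\<close> matter.
\<close>

definition monochromatic_clique :: "('a set \<Rightarrow> nat) \<Rightarrow> 'a set \<Rightarrow> bool" where
  "monochromatic_clique \<chi> S \<longleftrightarrow> (\<forall>e \<in> [S]\<^bsup>2\<^esup>. \<forall>f \<in> [S]\<^bsup>2\<^esup>. \<chi> e = \<chi> f)"

definition rainbow_clique :: "('a set \<Rightarrow> nat) \<Rightarrow> 'a set \<Rightarrow> bool" where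
  "rainbow_clique \<chi> S \<longleftrightarrow> (\<forall>e \<in> [S]\<^bsup>2\<^esup>. \<forall>f \<in> [S]\<^bsup>2\<^esup>. e \<noteq> f \<longrightarrow> \<chi> e \<noteq> \<chi> f)"

definition lexical_clique :: "('a set \<Rightarrow> nat) \<Rightarrow> 'a set \<Rightarrow> bool" where
  "lexical_clique \<chi> S \<longleftrightarrow>
     (\<exists>v. bij_betw v {1..card S} S \<and>
        (\<forall>i\<in>{1..card S}. \<forall>j\<in>{1..card S}. \<forall>i'\<in>{1..card S}. \<forall>j'\<in>{1..card S}.
           i < j \<and> i' < j' \<longrightarrow> (\<chi> {v i, v j} = \<chi> {v i', v j'} \<longleftrightarrow> i = i')))"

definition er_unavoidable :: "nat \<Rightarrow> nat \<Rightarrow> nat \<Rightarrow> nat \<Rightarrow> bool" where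
  "er_unavoidable m l r n \<longleftrightarrow>
     (\<forall>\<chi> :: nat set \<Rightarrow> nat.
        (\<exists>S \<subseteq> {1..n}. card S = m \<and> monochromatic_clique \<chi> S) \<or>
        (\<exists>S \<subseteq> {1..n}. card S = l \<and> lexical_clique \<chi> S) \<or>
        (\<exists>S \<subseteq> {1..n}. card S = r \<and> rainbow_clique \<chi> S))"

text \<open>
  By the canonical Ramsey theorem of Erdos and Rado the minimum exists.  If it did not, \<open>LEAST\<close>
  would be an unspecified number (unlike \<open>Inf\<close> on \<open>nat\<close>, which is \<open>0\<close> on the empty set), so a
  proof of an upper bound on \<open>ER m l r\<close> has to exhibit some \<open>n\<close> with the property.
\<close>

definition ER :: "nat \<Rightarrow> nat \<Rightarrow> nat \<Rightarrow> nat" where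
  "ER m l r = (LEAST n. er_unavoidable m l r n)"

end

theory Submission
  imports Defs "HOL-Real_Asymp.Real_Asymp"
begin

text \<open>
  Everything rests on one fact: if every color has degree at most \<open>d\<close> at every vertex and there are
  at least \<open>C d r\<^sup>3 / ln r\<close> vertices, then there is a rainbow \<open>K\<^sub>r\<close>. Call a 4-set a conflict if
  it contains two disjoint edges of the same color; any three vertices lie in at most \<open>3 d\<close>
  conflicts. In a random vertex set \<open>U\<close> of size about \<open>r\<^bsup>1.1\<^esup>\<close> the conflicts are locally
  tree-like around most vertices \<open>v\<close>, so that a uniformly random conflict-free \<open>W \<subseteq> U - {v}\<close> can be
  extended by \<open>v\<close> with probability at least \<open>4 powr - E\<close>, where \<open>E\<close> is the expected number of triples
  of \<open>W\<close> that conflict with \<open>v\<close> (the method of Shearer and Alon, in the form of Kostochka, Mubayi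
  and Verstraete). Summed over all \<open>v\<close>, the number of such triples is at most \<open>3 d |W|\<^sup>3\<close>,
  so if all conflict-free sets were small, then \<open>E\<close> would be at most a small multiple of \<open>ln r\<close> for
  a typical \<open>v\<close>, and the resulting occupation probabilities in \<open>U\<close> would add up to more than \<open>2 r\<close>.
  Pairs of adjacent edges of equal color are rare in \<open>U\<close> and are destroyed by deleting vertices.

  Hence a coloring without rainbow \<open>K\<^sub>r\<close> has a large monochromatic star. For (1) its leaves form a
  monochromatic clique, for (2) one recurses into its leaves, and for (3) a maximal rainbow set
  among the leaves that avoids the color of the star is already large enough.
\<close>

section \<open>Random independent sets in sparse 4-uniform hypergraphs\<close>

text \<open>Jensen's inequality for the convex function \<open>exp (- t * x)\<close>: each term is
  bounded below by the tangent at the weighted mean, and the linear parts of the tangents cancel in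
  the weighted sum.\<close>

lemma exp_weighted_mean_le:
  fixes w x :: "'a \<Rightarrow> real"
  assumes "\<And>i. i \<in> I \<Longrightarrow> w i \<ge> 0" and pos: "(\<Sum>i\<in>I. w i) > 0"
  shows "(\<Sum>i\<in>I. w i) * exp (- t * ((\<Sum>i\<in>I. w i * x i) / (\<Sum>i\<in>I. w i)))
           \<le> (\<Sum>i\<in>I. w i * exp (- t * x i))"
proof -
  define s where "s = (\<Sum>i\<in>I. w i)"
  define \<mu> where "\<mu> = (\<Sum>i\<in>I. w i * x i) / s"
  have s: "s > 0" using pos by (simp add: s_def)
  have "(\<Sum>i\<in>I. w i * (exp (- t * \<mu>) * (1 - t * (x i - \<mu>))))
      = (\<Sum>i\<in>I. exp (- t * \<mu>) * (w i - t * (w i * x i - w i * \<mu>)))"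
    by (simp add: algebra_simps)
  also have "\<dots> = exp (- t * \<mu>) * (s - t * ((\<Sum>i\<in>I. w i * x i) - s * \<mu>))"
    by (simp only: s_def sum_subtractf flip: sum_distrib_left sum_distrib_right)
  also have "\<dots> = exp (- t * \<mu>) * s" using s by (simp add: \<mu>_def)
  finally have "(\<Sum>i\<in>I. w i * (exp (- t * \<mu>) * (1 - t * (x i - \<mu>)))) = s * exp (- t * \<mu>)"
    by simp
  moreover have "exp (- t * \<mu>) * (1 - t * (x i - \<mu>)) \<le> exp (- t * x i)" for i
  proof -
    have "exp (- t * \<mu>) * (1 - t * (x i - \<mu>)) \<le> exp (- t * \<mu>) * exp (- t * (x i - \<mu>))"
      using exp_ge_add_one_self[of "- t * (x i - \<mu>)"] by (intro mult_left_mono) auto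
    also have "\<dots> = exp (- t * x i)" by (simp add: algebra_simps flip: exp_add)
    finally show ?thesis .
  qed
  ultimately show ?thesis
    using assms(1) by (fold s_def, fold \<mu>_def)
      (smt (verit) mult.commute mult_left_mono sum_mono)
qed

section \<open>Independent sets, links, and a local condition at a vertex\<close>

definition indep_sets :: "'a set set \<Rightarrow> 'a set \<Rightarrow> 'a set set" where
  "indep_sets H U = {W. W \<subseteq> U \<and> (\<forall>e\<in>H. \<not> e \<subseteq> W)}"

definition link :: "'a set set \<Rightarrow> 'a \<Rightarrow> 'a set set" where
  "link H v = {f. v \<notin> f \<and> insert v f \<in> H}"

text \<open>Local tree-likeness at \<open>v\<close>, used with \<open>v\<close> outside
  \<open>U\<close>. The first clause excludes two edges through \<open>v\<close> with another common
  vertex, the second an edge inside \<open>U\<close> that joins two edges through \<open>v\<close>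
  and so closes a triangle.\<close>

definition uncrowded :: "'a set set \<Rightarrow> 'a set \<Rightarrow> 'a \<Rightarrow> bool" where
  "uncrowded H U v \<longleftrightarrow>
     (\<forall>f\<in>link H v. \<forall>g\<in>link H v. f \<subseteq> U \<longrightarrow> g \<subseteq> U \<longrightarrow> f \<noteq> g \<longrightarrow>
        f \<inter> g = {} \<and> (\<forall>h\<in>H. h \<subseteq> U \<longrightarrow> h \<inter> f = {} \<or> h \<inter> g = {}))"

lemma indep_sets_mono: "U \<subseteq> U' \<Longrightarrow> indep_sets H U \<subseteq> indep_sets H U'"
  by (auto simp: indep_sets_def)

lemma finite_indep_sets: "finite U \<Longrightarrow> finite (indep_sets H U)"
  by (rule finite_subset[of _ "Pow U"]) (auto simp: indep_sets_def)

lemma indep_sets_subset_closed: "W \<in> indep_sets H U \<Longrightarrow> W' \<subseteq> W \<Longrightarrow> W' \<in> indep_sets H U"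
  by (fastforce simp: indep_sets_def)

lemma card_indep_sets_pos:
  assumes "finite U" "{} \<notin> H"
  shows "card (indep_sets H U) > 0"
proof -
  have "{} \<in> indep_sets H U" using assms(2) by (auto simp: indep_sets_def)
  then show ?thesis using finite_indep_sets[OF assms(1)] by (auto simp: card_gt_0_iff)
qed

lemma card_subsets_avoiding:
  assumes "finite A" "X \<subseteq> A"
  shows "card {Y. Y \<subseteq> A \<and> Y \<inter> X = {}} = 2 ^ (card A - card X)"
proof -
  have "{Y. Y \<subseteq> A \<and> Y \<inter> X = {}} = Pow (A - X)" by auto
  then show ?thesis using assms by (simp add: card_Pow card_Diff_subset finite_subset)
qed

text \<open>Pairing \<open>Y\<close> with \<open>A - Y\<close> shows that a uniformly random subset
  of \<open>A\<close> contains half of \<open>X\<close> on average.\<close>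

lemma sum_card_inter_Pow:
  assumes "finite A" "X \<subseteq> A"
  shows "2 * (\<Sum>Y\<in>Pow A. card (Y \<inter> X)) = card X * 2 ^ card A"
proof -
  have fX: "finite X" using assms finite_subset by blast
  have "(\<Sum>Y\<in>Pow A. card ((A - Y) \<inter> X)) = (\<Sum>Y\<in>Pow A. card (Y \<inter> X))"
    by (rule sum.reindex_bij_witness[of _ "\<lambda>Y. A - Y" "\<lambda>Y. A - Y"]) (auto simp: double_diff)
  then have "2 * (\<Sum>Y\<in>Pow A. card (Y \<inter> X))
      = (\<Sum>Y\<in>Pow A. card (Y \<inter> X) + card ((A - Y) \<inter> X))"
    by (simp add: sum.distrib)
  also have "\<dots> = (\<Sum>Y\<in>Pow A. card X)"
  proof (intro sum.cong refl)
    fix Y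
    have "card ((Y \<inter> X) \<union> ((A - Y) \<inter> X)) = card (Y \<inter> X) + card ((A - Y) \<inter> X)"
      using fX by (intro card_Un_disjoint) auto
    moreover have "(Y \<inter> X) \<union> ((A - Y) \<inter> X) = X" using assms(2) by auto
    ultimately show "card (Y \<inter> X) + card ((A - Y) \<inter> X) = card X" by simp
  qed
  also have "\<dots> = card X * 2 ^ card A" using assms(1) by (simp add: card_Pow)
  finally show ?thesis .
qed

text \<open>
  Let \<open>A\<close> contain one vertex of each link edge of \<open>v\<close>. Since no edge meets \<open>A\<close> twice, a uniformly
  random independent set, conditioned on its part \<open>b\<close> outside \<open>A\<close>, is \<open>b\<close> together with a uniformly
  random subset of those vertices of \<open>A\<close> that \<open>b\<close> does not block.
\<close>

lemma unblocked_fraction_ge: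
  assumes U: "finite U" and H: "{} \<notin> H" and unc: "uncrowded H U v"
    and link_ne: "{} \<notin> link H v" and v: "v \<notin> U"
  defines "Z \<equiv> real (card (indep_sets H U))"
  defines "X \<equiv> \<lambda>W. real (card {f \<in> link H v. f \<subseteq> W})"
  shows "Z * exp (- ln 4 * ((\<Sum>W\<in>indep_sets H U. X W) / Z))
           \<le> real (card {W \<in> indep_sets H U. insert v W \<in> indep_sets H (insert v U)})"
proof -
  define L where "L = {f \<in> link H v. f \<subseteq> U}"
  have finL: "finite L" by (rule finite_subset[of _ "Pow U"]) (use U in \<open>auto simp: L_def\<close>)
  have L_ne: "f \<noteq> {}" if "f \<in> L" for f using that link_ne by (auto simp: L_def)
  have L_unc: "f \<inter> g = {} \<and> (\<forall>h\<in>H. h \<subseteq> U \<longrightarrow> h \<inter> f = {} \<or> h \<inter> g = {})"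
    if "f \<in> L" "g \<in> L" "f \<noteq> g" for f g
    using unc[unfolded uncrowded_def, rule_format, of f g] that by (auto simp: L_def)
  have L_disj: "f \<inter> g = {}" if "f \<in> L" "g \<in> L" "f \<noteq> g" for f g
    using L_unc[OF that] by simp
  have L_far: "h \<inter> f = {} \<or> h \<inter> g = {}" if "f \<in> L" "g \<in> L" "f \<noteq> g" "h \<in> H" "h \<subseteq> U" for f g h
    using L_unc[OF that(1-3)] that(4,5) by simp
  obtain a where a: "\<And>f. f \<in> L \<Longrightarrow> a f \<in> f"
    using L_ne by (metis ex_in_conv)
  define A where "A = a ` L"
  have AU: "A \<subseteq> U" and finA: "finite A" using a finL by (auto simp: A_def L_def)
  have A_f: "f \<inter> A = {a f}" if "f \<in> L" for f
    using that a L_disj unfolding A_def by blast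
  \<comment> \<open>Different vertices of \<open>A\<close> represent different link edges, and no
    edge inside \<open>U\<close> meets two link edges.\<close>
  have A_h: "x = y" if h: "h \<in> H" "h \<subseteq> U" "x \<in> h \<inter> A" "y \<in> h \<inter> A" for h x y
  proof -
    obtain f g where fg: "f \<in> L" "g \<in> L" "x = a f" "y = a g"
      using h(3,4) by (auto simp: A_def)
    show ?thesis
    proof (cases "f = g")
      case False
      then have "h \<inter> f = {} \<or> h \<inter> g = {}" using L_far[OF fg(1,2) _ h(1,2)] by simp
      then show ?thesis using fg(3,4) a[OF fg(1)] a[OF fg(2)] h(3,4) by blast
    qed (use fg in simp)
  qed
  define B where "B = indep_sets H (U - A)"
  define Av where "Av b = {x \<in> A. insert x b \<in> indep_sets H U}" for b
  \<comment> \<open>Given \<open>b\<close>, any subset of \<open>Av b\<close> may be added. Taking a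
    vertex of \<open>Q b\<close> completes a link edge and thereby blocks \<open>v\<close>; leaving
    out all of \<open>Q b\<close> keeps every link edge incomplete.\<close>
  define Q where "Q b = {x \<in> Av b. \<exists>f\<in>L. a f = x \<and> f - {x} \<subseteq> b}" for b
  have finB: "finite B" using U by (simp add: B_def finite_indep_sets)
  have finAv: "finite (Av b)" for b using finA by (simp add: Av_def)
  have QAv: "Q b \<subseteq> Av b" for b by (auto simp: Q_def)
  have AvA: "Av b \<subseteq> A" for b by (auto simp: Av_def)
  \<comment> \<open>An edge inside \<open>b \<union> Y\<close> contains at most one vertex of
    \<open>A\<close>, so it is enough that each vertex of \<open>Y\<close> can be added to
    \<open>b\<close> on its own.\<close>
  have split: "b \<union> Y \<in> indep_sets H U" if "b \<in> B" "Y \<subseteq> Av b" for b Y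
  proof -
    have "\<not> h \<subseteq> b \<union> Y" if h: "h \<in> H" for h
    proof
      assume sub: "h \<subseteq> b \<union> Y"
      have hU: "h \<subseteq> U" using sub \<open>b \<in> B\<close> \<open>Y \<subseteq> Av b\<close> AvA AU
        unfolding B_def indep_sets_def by blast
      have bA: "b \<inter> A = {}" using \<open>b \<in> B\<close> by (auto simp: B_def indep_sets_def)
      show False
      proof (cases "h \<inter> A = {}")
        case True
        then have "h \<subseteq> b" using sub \<open>Y \<subseteq> Av b\<close> AvA by blast
        then show False using h \<open>b \<in> B\<close> by (auto simp: B_def indep_sets_def)
      next
        case False
        then obtain x where x: "x \<in> h" "x \<in> A" by auto
        then have "h \<inter> A = {x}" using A_h[OF h hU] by auto
        then have "h \<subseteq> insert x b" "x \<in> Y"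
          using sub \<open>Y \<subseteq> Av b\<close> AvA x bA by blast+
        then show False using h \<open>Y \<subseteq> Av b\<close> by (auto simp: Av_def indep_sets_def)
      qed
    qed
    moreover have "b \<union> Y \<subseteq> U"
      using that AvA[of b] AU unfolding B_def indep_sets_def by blast
    ultimately show ?thesis by (simp add: indep_sets_def)
  qed
  have bij: "bij_betw (\<lambda>(b, Y). b \<union> Y) (SIGMA b:B. Pow (Av b)) (indep_sets H U)"
  proof (rule bij_betw_byWitness[where f' = "\<lambda>W. (W - A, W \<inter> A)"])
    show "\<forall>p\<in>SIGMA b:B. Pow (Av b). (\<lambda>W. (W - A, W \<inter> A)) ((\<lambda>(b, Y). b \<union> Y) p) = p"
      using AvA by (fastforce simp: B_def indep_sets_def)
    show "\<forall>W\<in>indep_sets H U. (\<lambda>(b, Y). b \<union> Y) (W - A, W \<inter> A) = W" by auto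
    show "(\<lambda>(b, Y). b \<union> Y) ` (SIGMA b:B. Pow (Av b)) \<subseteq> indep_sets H U" using split by auto
    show "(\<lambda>W. (W - A, W \<inter> A)) ` indep_sets H U \<subseteq> (SIGMA b:B. Pow (Av b))"
    proof safe
      fix W assume W: "W \<in> indep_sets H U"
      show "W - A \<in> B" using W unfolding B_def indep_sets_def by blast
      fix x assume x: "x \<in> W" "x \<in> A"
      have "insert x (W - A) \<in> indep_sets H U"
        by (rule indep_sets_subset_closed[OF W]) (use x in auto)
      then show "x \<in> Av (W - A)" using x by (simp add: Av_def)
    qed
  qed
  have f_iff: "f \<subseteq> b \<union> Y \<longleftrightarrow> a f \<in> Y \<and> f - {a f} \<subseteq> b" if "f \<in> L" "b \<in> B" "Y \<subseteq> Av b" for f b Y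
  proof -
    have "b \<inter> A = {}" using \<open>b \<in> B\<close> by (auto simp: B_def indep_sets_def)
    then show ?thesis using A_f[OF \<open>f \<in> L\<close>] that(3) AvA by blast
  qed
  have sum_split: "(\<Sum>W\<in>indep_sets H U. F W) = (\<Sum>b\<in>B. \<Sum>Y\<in>Pow (Av b). F (b \<union> Y))" for F :: "_ \<Rightarrow> real"
  proof -
    have "(\<Sum>W\<in>indep_sets H U. F W) = (\<Sum>(b, Y)\<in>(SIGMA b:B. Pow (Av b)). F (b \<union> Y))"
      using sum.reindex_bij_betw[OF bij, of F] by (simp add: case_prod_unfold)
    also have "\<dots> = (\<Sum>b\<in>B. \<Sum>Y\<in>Pow (Av b). F (b \<union> Y))"
      using finB finAv by (subst sum.Sigma) auto
    finally show ?thesis .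
  qed
  have X_eq: "X W = real (card {f \<in> L. f \<subseteq> W})" if "W \<subseteq> U" for W
    unfolding X_def L_def using that by (intro arg_cong[of _ _ "\<lambda>s. real (card s)"]) auto
  have Z_eq: "Z = (\<Sum>b\<in>B. 2 ^ card (Av b))"
    using sum_split[of "\<lambda>_. 1"] finAv by (simp add: Z_def card_Pow)
  have Zpos: "Z > 0" using card_indep_sets_pos[OF U H] by (simp add: Z_def)
  \<comment> \<open>For fixed \<open>b\<close>, the vertices of \<open>Q b\<close> taken into
    \<open>Y\<close> complete different link edges inside \<open>b \<union> Y\<close>. On average
    over \<open>Y\<close> half of \<open>Q b\<close> is taken, hence the factor 2.\<close>
  have X_ge: "(\<Sum>b\<in>B. 2 ^ card (Av b) * real (card (Q b))) \<le> 2 * (\<Sum>W\<in>indep_sets H U. X W)"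
  proof -
    have "2 ^ card (Av b) * real (card (Q b)) \<le> 2 * (\<Sum>Y\<in>Pow (Av b). X (b \<union> Y))" if b: "b \<in> B" for b
    proof -
      have "real (card (Y \<inter> Q b)) \<le> X (b \<union> Y)" if Y: "Y \<in> Pow (Av b)" for Y
      proof -
        have "b \<union> Y \<subseteq> U" using split[OF b] Y by (auto simp: indep_sets_def)
        have "Y \<inter> Q b \<subseteq> a ` {f \<in> L. f \<subseteq> b \<union> Y}"
          using f_iff[OF _ b] Y by (auto simp: Q_def)
        then have "card (Y \<inter> Q b) \<le> card {f \<in> L. f \<subseteq> b \<union> Y}"
          using finL surj_card_le[of "{f \<in> L. f \<subseteq> b \<union> Y}"] by auto
        then show ?thesis using X_eq[OF \<open>b \<union> Y \<subseteq> U\<close>] by simp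
      qed
      then have "real (\<Sum>Y\<in>Pow (Av b). card (Y \<inter> Q b)) \<le> (\<Sum>Y\<in>Pow (Av b). X (b \<union> Y))"
        unfolding of_nat_sum by (intro sum_mono)
      moreover have "real (2 * (\<Sum>Y\<in>Pow (Av b). card (Y \<inter> Q b))) = real (card (Q b) * 2 ^ card (Av b))"
        using sum_card_inter_Pow[OF finAv QAv] by (simp only:)
      ultimately show ?thesis by (simp add: mult.commute)
    qed
    then have "(\<Sum>b\<in>B. 2 ^ card (Av b) * real (card (Q b)))
        \<le> (\<Sum>b\<in>B. 2 * (\<Sum>Y\<in>Pow (Av b). X (b \<union> Y)))" by (intro sum_mono)
    then show ?thesis by (simp add: sum_split sum_distrib_left)
  qed
  have unb: "{W \<in> indep_sets H U. insert v W \<in> indep_sets H (insert v U)}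
      = {W \<in> indep_sets H U. \<forall>f\<in>L. \<not> f \<subseteq> W}" (is "?A = ?B")
  proof (intro Collect_cong conj_cong refl)
    fix W assume W: "W \<in> indep_sets H U"
    have "(\<exists>h\<in>H. h \<subseteq> insert v W) \<longleftrightarrow> (\<exists>f\<in>L. f \<subseteq> W)"
    proof
      assume "\<exists>h\<in>H. h \<subseteq> insert v W"
      then obtain h where h: "h \<in> H" "h \<subseteq> insert v W" by auto
      have "\<not> h \<subseteq> W" using W h by (auto simp: indep_sets_def)
      then have "v \<in> h" using h by auto
      then have "h - {v} \<in> L" using h W by (auto simp: L_def link_def indep_sets_def insert_absorb)
      then show "\<exists>f\<in>L. f \<subseteq> W" using h by blast
    next
      assume "\<exists>f\<in>L. f \<subseteq> W"
      then show "\<exists>h\<in>H. h \<subseteq> insert v W" unfolding L_def link_def by blast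
    qed
    then show "(insert v W \<in> indep_sets H (insert v U)) \<longleftrightarrow> (\<forall>f\<in>L. \<not> f \<subseteq> W)"
      using W by (auto simp: indep_sets_def)
  qed
  have "real (card ?A) = (\<Sum>W\<in>indep_sets H U. if \<forall>f\<in>L. \<not> f \<subseteq> W then 1 else 0)"
    unfolding unb using finite_indep_sets[OF U] by (simp add: sum.If_cases Int_def)
  also have "\<dots> = (\<Sum>b\<in>B. \<Sum>Y\<in>Pow (Av b). if \<forall>f\<in>L. \<not> f \<subseteq> b \<union> Y then 1 else 0)"
    by (rule sum_split)
  \<comment> \<open>For fixed \<open>b\<close>, the sets \<open>Y\<close> that leave
    \<open>v\<close> unblocked are exactly the subsets of \<open>Av b\<close> that avoid
    \<open>Q b\<close>.\<close>
  also have "\<dots> = (\<Sum>b\<in>B. real (2 ^ (card (Av b) - card (Q b))))"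
  proof (intro sum.cong refl)
    fix b assume b: "b \<in> B"
    have "(\<Sum>Y\<in>Pow (Av b). if \<forall>f\<in>L. \<not> f \<subseteq> b \<union> Y then 1 else 0)
        = real (card {Y \<in> Pow (Av b). \<forall>f\<in>L. \<not> f \<subseteq> b \<union> Y})"
      using finAv by (simp add: sum.If_cases Int_def)
    also have "{Y \<in> Pow (Av b). \<forall>f\<in>L. \<not> f \<subseteq> b \<union> Y} = {Y. Y \<subseteq> Av b \<and> Y \<inter> Q b = {}}"
      using f_iff[OF _ b] by (auto simp: Q_def; blast)
    also have "card \<dots> = 2 ^ (card (Av b) - card (Q b))"
      by (rule card_subsets_avoiding[OF finAv QAv])
    finally show "(\<Sum>Y\<in>Pow (Av b). if \<forall>f\<in>L. \<not> f \<subseteq> b \<union> Y then 1 else 0)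
        = real (2 ^ (card (Av b) - card (Q b)))" .
  qed
  also have "\<dots> = (\<Sum>b\<in>B. 2 ^ card (Av b) * exp (- ln 2 * real (card (Q b))))"
  proof (intro sum.cong refl)
    fix b
    have "exp (- ln 2 * real (card (Q b))) = inverse (2 ^ card (Q b))"
      by (simp add: exp_minus mult.commute[of "ln 2"] exp_of_nat_mult)
    moreover have "card (Q b) \<le> card (Av b)" using QAv finAv by (simp add: card_mono)
    ultimately show "real (2 ^ (card (Av b) - card (Q b)))
        = 2 ^ card (Av b) * exp (- ln 2 * real (card (Q b)))"
      using power_diff[of "2::real" "card (Q b)" "card (Av b)"] by (simp add: divide_inverse)
  qed
  finally have count: "real (card ?A) = (\<Sum>b\<in>B. 2 ^ card (Av b) * exp (- ln 2 * real (card (Q b))))" .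
  \<comment> \<open>Given \<open>b\<close>, the vertex \<open>v\<close> is unblocked with
    probability 2 to the power of minus \<open>card (Q b)\<close>. The mean of
    \<open>card (Q b)\<close> is at most twice that of \<open>X\<close>, so convexity gives the base
    4.\<close>
  have ln4: "ln (4::real) = 2 * ln 2" using ln_realpow[of 2 2] by simp
  have "Z * exp (- ln 4 * ((\<Sum>W\<in>indep_sets H U. X W) / Z))
      \<le> Z * exp (- ln 2 * ((\<Sum>b\<in>B. 2 ^ card (Av b) * real (card (Q b))) / Z))"
    using X_ge Zpos by (simp add: ln4 divide_simps)
  also have "\<dots> \<le> real (card ?A)"
    unfolding count using exp_weighted_mean_le[of B "\<lambda>b. 2 ^ card (Av b)" "ln 2" "\<lambda>b. real (card (Q b))"] Zpos
    unfolding Z_eq by simp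
  finally show ?thesis .
qed

section \<open>Occupation probabilities in random independent sets\<close>

lemma card_indep_sets_containing:
  assumes "v \<in> U"
  shows "card {W \<in> indep_sets H U. v \<in> W}
      = card {W \<in> indep_sets H (U - {v}). insert v W \<in> indep_sets H U}"
proof (rule bij_betw_same_card[of "\<lambda>W. W - {v}"], rule bij_betw_byWitness[where f' = "insert v"])
  show "(\<lambda>W. W - {v}) ` {W \<in> indep_sets H U. v \<in> W}
      \<subseteq> {W \<in> indep_sets H (U - {v}). insert v W \<in> indep_sets H U}"
    by (auto simp: insert_absorb) (auto simp: indep_sets_def)
  show "insert v ` {W \<in> indep_sets H (U - {v}). insert v W \<in> indep_sets H U}
      \<subseteq> {W \<in> indep_sets H U. v \<in> W}" by auto
  show "\<forall>W\<in>{W \<in> indep_sets H U. v \<in> W}. insert v (W - {v}) = W" by auto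
  show "\<forall>W\<in>{W \<in> indep_sets H (U - {v}). insert v W \<in> indep_sets H U}. insert v W - {v} = W"
    by (auto simp: indep_sets_def)
qed

text \<open>Deleting \<open>v\<close> maps the sets that contain \<open>v\<close> injectively to
  independent subsets of \<open>U - {v}\<close>; the other sets already are such subsets.\<close>

lemma card_indep_sets_remove:
  assumes "finite U" "v \<in> U"
  shows "card (indep_sets H U) \<le> 2 * card (indep_sets H (U - {v}))"
proof -
  have fin: "finite (indep_sets H (U - {v}))" using assms by (simp add: finite_indep_sets)
  have "indep_sets H U = {W \<in> indep_sets H U. v \<in> W} \<union> {W \<in> indep_sets H U. v \<notin> W}" by auto
  then have "card (indep_sets H U)
      \<le> card {W \<in> indep_sets H U. v \<in> W} + card {W \<in> indep_sets H U. v \<notin> W}"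
    by (metis card_Un_le)
  also have "card {W \<in> indep_sets H U. v \<in> W} \<le> card (indep_sets H (U - {v}))"
    unfolding card_indep_sets_containing[OF assms(2)] using fin by (intro card_mono) auto
  also have "card {W \<in> indep_sets H U. v \<notin> W} \<le> card (indep_sets H (U - {v}))"
    using fin by (intro card_mono) (auto simp: indep_sets_def)
  finally show ?thesis by simp
qed

definition mean_links :: "'a set set \<Rightarrow> 'a set \<Rightarrow> 'a \<Rightarrow> real" where
  "mean_links H U v =
     (\<Sum>W\<in>indep_sets H U. real (card {f \<in> link H v. f \<subseteq> W})) / real (card (indep_sets H U))"

text \<open>The sets that contain \<open>v\<close> correspond to the independent subsets of
  \<open>U - {v}\<close> that \<open>v\<close> extends. These are a fraction of at least 4 to the
  power of minus the mean, and adding \<open>v\<close> to the ground set at most doubles the number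
  of independent sets, hence the division by 2.\<close>

lemma occupation_probability_ge:
  assumes U: "finite U" and H: "{} \<notin> H" "{v} \<notin> H" and v: "v \<in> U"
    and unc: "uncrowded H (U - {v}) v"
  shows "exp (- ln 4 * mean_links H (U - {v}) v) / 2
           \<le> real (card {W \<in> indep_sets H U. v \<in> W}) / real (card (indep_sets H U))"
proof -
  let ?Z = "real (card (indep_sets H U))" and ?Z' = "real (card (indep_sets H (U - {v})))"
  have pos: "?Z > 0" "?Z' > 0" using card_indep_sets_pos U H by auto
  have "?Z' * exp (- ln 4 * mean_links H (U - {v}) v) \<le> real (card {W \<in> indep_sets H U. v \<in> W})"
    using unblocked_fraction_ge[OF _ H(1) unc] U H v
    by (simp add: card_indep_sets_containing mean_links_def insert_absorb link_def)
  moreover have "?Z * (exp (- ln 4 * mean_links H (U - {v}) v) / 2)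
      \<le> (2 * ?Z') * (exp (- ln 4 * mean_links H (U - {v}) v) / 2)"
    using card_indep_sets_remove[OF U v, of H] by (intro mult_right_mono) auto
  ultimately have "?Z * (exp (- ln 4 * mean_links H (U - {v}) v) / 2)
      \<le> real (card {W \<in> indep_sets H U. v \<in> W})" by linarith
  then show ?thesis using pos(1) by (subst pos_le_divide_eq) (simp_all add: mult.commute)
qed

text \<open>Send \<open>(v, f)\<close> to the triple \<open>f\<close> and the edge
  \<open>insert v f\<close>. As \<open>v\<close> is the only vertex of that edge outside
  \<open>f\<close>, this is injective, and each triple of \<open>W\<close> lies in at most
  \<open>D\<close> edges. The bound is the same for every \<open>T\<close>, so all vertices are
  handled at once.\<close>

lemma sum_card_link_le:
  assumes H: "H \<subseteq> [V]\<^bsup>4\<^esup>" and V: "finite V" and W: "W \<subseteq> V" and T: "finite T"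
    and codeg: "\<And>S. S \<in> [V]\<^bsup>3\<^esup> \<Longrightarrow> card {e \<in> H. S \<subseteq> e} \<le> D"
  shows "(\<Sum>v\<in>T. card {f \<in> link H v. f \<subseteq> W}) \<le> D * card W ^ 3"
proof -
  have finW: "finite W" using W V finite_subset by blast
  have finH: "finite H" using H V finite_imp_finite_nsets finite_subset by blast
  have "(\<Sum>v\<in>T. card {f \<in> link H v. f \<subseteq> W}) = card (SIGMA v:T. {f \<in> link H v. f \<subseteq> W})"
    using T finW by simp
  also have "\<dots> \<le> card (SIGMA S:[W]\<^bsup>3\<^esup>. {e \<in> H. S \<subseteq> e})"
  proof (rule card_inj_on_le[of "\<lambda>(v, f). (f, insert v f)"])
    show "inj_on (\<lambda>(v, f). (f, insert v f)) (SIGMA v:T. {f \<in> link H v. f \<subseteq> W})"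
      by (auto simp: inj_on_def link_def)
    show "(\<lambda>(v, f). (f, insert v f)) ` (SIGMA v:T. {f \<in> link H v. f \<subseteq> W})
        \<subseteq> (SIGMA S:[W]\<^bsup>3\<^esup>. {e \<in> H. S \<subseteq> e})"
    proof clarsimp
      fix v f assume f: "f \<in> link H v" "f \<subseteq> W"
      then have fin: "finite f" "v \<notin> f" "insert v f \<in> H" using finW finite_subset by (auto simp: link_def)
      then have "card (insert v f) = 4" using H by (auto simp: nsets_def)
      then show "f \<in> [W]\<^bsup>3\<^esup> \<and> insert v f \<in> H \<and> f \<subseteq> insert v f"
        using fin f by (auto simp: nsets_def)
    qed
    show "finite (SIGMA S:[W]\<^bsup>3\<^esup>. {e \<in> H. S \<subseteq> e})"
      using finW finH by (simp add: finite_imp_finite_nsets)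
  qed
  also have "\<dots> = (\<Sum>S\<in>[W]\<^bsup>3\<^esup>. card {e \<in> H. S \<subseteq> e})"
    using finW finH by (simp add: finite_imp_finite_nsets)
  also have "\<dots> \<le> (\<Sum>S\<in>[W]\<^bsup>3\<^esup>. D)"
    using codeg nsets_mono[OF W] by (intro sum_mono) blast
  also have "\<dots> = D * (card W choose 3)" by simp
  also have "\<dots> \<le> D * card W ^ 3"
  proof (cases "3 \<le> card W")
    case True
    then show ?thesis by (intro mult_left_mono binomial_le_pow) auto
  qed (simp add: binomial_eq_0)
  finally show ?thesis .
qed

text \<open>
  \<open>G\<close> is the set of well-behaved pairs \<open>(U, v)\<close>. The sum of the occupation probabilities of \<open>v\<close> in
  \<open>U\<close> over \<open>G\<close> is at most \<open>s\<close> for each \<open>U\<close>; the lower bounds for these probabilities are averaged by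
  grouping the pairs according to \<open>U - {v}\<close>, whose links at all vertices of \<open>V\<close> are bounded at once.
\<close>

lemma sample_size_le_independence_number:
  assumes V: "finite V" "card V = n" and H: "H \<subseteq> [V]\<^bsup>4\<^esup>"
    and codeg: "\<And>S. S \<in> [V]\<^bsup>3\<^esup> \<Longrightarrow> card {e \<in> H. S \<subseteq> e} \<le> D"
    and \<kappa>: "1 \<le> \<kappa>" "\<kappa> \<le> n"
    and G: "G \<subseteq> (SIGMA U:[V]\<^bsup>\<kappa>\<^esup>. U)" "\<kappa> * (n choose \<kappa>) \<le> 2 * card G"
    and unc: "\<And>U v. (U, v) \<in> G \<Longrightarrow> uncrowded H (U - {v}) v"
    and alpha: "\<And>U v W. (U, v) \<in> G \<Longrightarrow> W \<in> indep_sets H U \<Longrightarrow> card W \<le> s"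
  shows "real \<kappa> \<le> 4 * real s * exp (ln 4 * (2 * real D * real s ^ 3 / real (n - \<kappa> + 1)))"
proof -
  define occ where "occ U v = real (card {W \<in> indep_sets H U. v \<in> W}) / real (card (indep_sets H U))" for U v
  define \<mu> where "\<mu> U v = mean_links H (U - {v}) v" for U v
  have H_card: "card e = 4" if "e \<in> H" for e using that H by (auto simp: nsets_def)
  have H0: "{} \<notin> H" "{v} \<notin> H" for v using H_card by fastforce+
  have finP: "finite ([V]\<^bsup>j\<^esup>)" for j using V by (simp add: finite_imp_finite_nsets)
  have finU: "finite U" if "U \<in> [V]\<^bsup>j\<^esup>" for U j using that by (auto simp: nsets_def)
  have finG: "finite G" by (rule finite_subset[OF G(1)]) (use finP finU in auto)
  have choose_pos: "n choose \<kappa> > 0" using \<kappa> by simp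
  have G_pos: "real (card G) > 0"
  proof -
    have "0 < \<kappa> * (n choose \<kappa>)" using choose_pos \<kappa> by simp
    then have "0 < card G" using G(2) by linarith
    then show ?thesis by simp
  qed
  have occ_ge: "exp (- ln 4 * \<mu> U v) / 2 \<le> occ U v" if "(U, v) \<in> G" for U v
    unfolding occ_def \<mu>_def using that G(1) finU unc H0
    by (intro occupation_probability_ge) auto
  have occ_sum: "(\<Sum>(U, v)\<in>G. occ U v) \<le> real s * real (n choose \<kappa>)"
  proof -
    have fib: "G = (SIGMA U:fst ` G. {v. (U, v) \<in> G})" by force
    have fin_fib: "finite {v. (U, v) \<in> G}" for U
      using finite_Image[OF finG, of "{U}"] by (simp add: Image_singleton)
    have "(\<Sum>(U, v)\<in>G. occ U v) = (\<Sum>U\<in>fst ` G. \<Sum>v | (U, v) \<in> G. occ U v)"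
      using sum.Sigma[of "fst ` G" "\<lambda>U. {v. (U, v) \<in> G}" occ] finG fin_fib
      by (simp flip: fib)
    also have "\<dots> \<le> (\<Sum>U\<in>fst ` G. real s)"
    proof (rule sum_mono)
      fix U assume "U \<in> fst ` G"
      then obtain v0 where v0: "(U, v0) \<in> G" by auto
      then have U: "U \<in> [V]\<^bsup>\<kappa>\<^esup>" using G(1) by auto
      let ?I = "indep_sets H U"
      have fI: "finite ?I" using finU[OF U] by (simp add: finite_indep_sets)
      have pos: "card ?I > 0" using card_indep_sets_pos[OF finU[OF U]] H0 by auto
      \<comment> \<open>Double counting: the probabilities that \<open>v\<close> belongs to a random
        \<open>W\<close> add up to at most the expected size of \<open>W\<close>.\<close>
      have "(\<Sum>v | (U, v) \<in> G. card {W \<in> ?I. v \<in> W}) \<le> (\<Sum>v\<in>U. card {W \<in> ?I. v \<in> W})"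
        using G(1) finU[OF U] by (intro sum_mono2) auto
      also have "\<dots> = (\<Sum>W\<in>?I. card {v \<in> U. v \<in> W})"
        using sum_multicount_gen[OF finU[OF U] fI, of "\<lambda>v W. v \<in> W" "\<lambda>W. card {v \<in> U. v \<in> W}"] by simp
      also have "\<dots> \<le> (\<Sum>W\<in>?I. s)"
      proof (rule sum_mono)
        fix W assume W: "W \<in> ?I"
        then have "{v \<in> U. v \<in> W} = W" by (auto simp: indep_sets_def)
        then show "card {v \<in> U. v \<in> W} \<le> s" using alpha[OF v0 W] by simp
      qed
      finally have "(\<Sum>v | (U, v) \<in> G. card {W \<in> ?I. v \<in> W}) \<le> s * card ?I" by (simp add: mult.commute)
      then have "real (\<Sum>v | (U, v) \<in> G. card {W \<in> ?I. v \<in> W}) \<le> real (s * card ?I)"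
        by (simp only: of_nat_le_iff)
      then show "(\<Sum>v | (U, v) \<in> G. occ U v) \<le> real s"
        using pos by (simp add: occ_def pos_divide_le_eq flip: sum_divide_distrib)
    qed
    also have "\<dots> = real s * real (card (fst ` G))" by simp
    also have "card (fst ` G) \<le> card ([V]\<^bsup>\<kappa>\<^esup>)" using G(1) finP by (intro card_mono) auto
    also have "\<dots> = n choose \<kappa>" using V by simp
    finally show ?thesis by (simp add: mult_left_mono)
  qed
  have \<mu>_sum: "(\<Sum>(U, v)\<in>G. \<mu> U v) \<le> real D * real s ^ 3 * real (n choose (\<kappa> - 1))"
  proof -
    define G' where "G' = (\<lambda>(U, v). (U - {v}, v)) ` G"
    have inj: "inj_on (\<lambda>(U, v). (U - {v}, v)) G" using G(1) by (fastforce simp: inj_on_def)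
    have finG': "finite G'" using finG by (simp add: G'_def)
    have fib: "G' = (SIGMA U:fst ` G'. {v. (U, v) \<in> G'})" by force
    have fin_fib: "finite {v. (U, v) \<in> G'}" for U
      using finite_Image[OF finG', of "{U}"] by (simp add: Image_singleton)
    have "(\<Sum>(U, v)\<in>G. \<mu> U v) = (\<Sum>(U, v)\<in>G'. mean_links H U v)"
      unfolding G'_def by (subst sum.reindex[OF inj]) (simp add: \<mu>_def case_prod_unfold)
    also have "\<dots> = (\<Sum>U\<in>fst ` G'. \<Sum>v | (U, v) \<in> G'. mean_links H U v)"
      using sum.Sigma[of "fst ` G'" "\<lambda>U. {v. (U, v) \<in> G'}" "mean_links H"] finG' fin_fib
      by (simp flip: fib)
    also have "\<dots> \<le> (\<Sum>U\<in>fst ` G'. real D * real s ^ 3)"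
    proof (rule sum_mono)
      fix U assume "U \<in> fst ` G'"
      then obtain U0 v0 where v0: "(U0, v0) \<in> G" "U = U0 - {v0}" by (auto simp: G'_def)
      from v0(1) G(1) have "U0 \<in> [V]\<^bsup>\<kappa>\<^esup>" by auto
      then have U: "U \<subseteq> V" "finite U" unfolding v0(2) by (auto simp: nsets_def)
      let ?I = "indep_sets H U"
      let ?T = "{v. (U, v) \<in> G'}"
      have fI: "finite ?I" using U by (simp add: finite_indep_sets)
      have pos: "card ?I > 0" using card_indep_sets_pos[OF U(2)] H0 by auto
      have "(\<Sum>v\<in>?T. \<Sum>W\<in>?I. card {f \<in> link H v. f \<subseteq> W})
          = (\<Sum>W\<in>?I. \<Sum>v\<in>?T. card {f \<in> link H v. f \<subseteq> W})" by (rule sum.swap)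
      also have "\<dots> \<le> (\<Sum>W\<in>?I. D * s ^ 3)"
      proof (rule sum_mono)
        fix W assume W: "W \<in> ?I"
        then have "W \<subseteq> V" using U by (auto simp: indep_sets_def)
        then have "(\<Sum>v\<in>?T. card {f \<in> link H v. f \<subseteq> W}) \<le> D * card W ^ 3"
          using H V fin_fib codeg by (intro sum_card_link_le)
        \<comment> \<open>\<open>alpha\<close> speaks of the full sample \<open>U0\<close>, but an
          independent subset of \<open>U0 - {v0}\<close> is also one of \<open>U0\<close>.\<close>
        moreover have "card W \<le> s"
          using alpha[OF v0(1)] indep_sets_mono[of U U0 H] v0(2) W by blast
        ultimately show "(\<Sum>v\<in>?T. card {f \<in> link H v. f \<subseteq> W}) \<le> D * s ^ 3"
          by (meson le_trans mult_le_mono2 power_mono zero_le)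
      qed
      finally have "(\<Sum>v\<in>?T. \<Sum>W\<in>?I. card {f \<in> link H v. f \<subseteq> W}) \<le> D * s ^ 3 * card ?I"
        by (simp add: mult.commute)
      then have "real (\<Sum>v\<in>?T. \<Sum>W\<in>?I. card {f \<in> link H v. f \<subseteq> W}) \<le> real (D * s ^ 3 * card ?I)"
        by (simp only: of_nat_le_iff)
      then show "(\<Sum>v | (U, v) \<in> G'. mean_links H U v) \<le> real D * real s ^ 3"
        using pos by (simp add: mean_links_def pos_divide_le_eq flip: sum_divide_distrib)
    qed
    also have "\<dots> = real D * real s ^ 3 * real (card (fst ` G'))" by simp
    also have "card (fst ` G') \<le> card ([V]\<^bsup>(\<kappa> - 1)\<^esup>)"
    proof (intro card_mono finP subsetI)
      fix U assume "U \<in> fst ` G'"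
      then obtain U0 v0 where v0: "(U0, v0) \<in> G" "U = U0 - {v0}" by (auto simp: G'_def)
      from v0(1) G(1) have "U0 \<in> [V]\<^bsup>\<kappa>\<^esup>" "v0 \<in> U0" by auto
      then show "U \<in> [V]\<^bsup>(\<kappa> - 1)\<^esup>" unfolding v0(2) by (auto simp: nsets_def)
    qed
    also have "\<dots> = n choose (\<kappa> - 1)" using V by simp
    finally show ?thesis by (simp add: mult_left_mono)
  qed
  \<comment> \<open>Both sides count pairs of a \<open>\<kappa>\<close>-set and one of its elements.
    This compares the number of sets of size \<open>\<kappa> - 1\<close> with the number of all
    pairs, at least half of which lie in \<open>G\<close>; that half is the factor 2 in
    \<open>E\<close>.\<close>
  have ch: "real (n - \<kappa> + 1) * real (n choose (\<kappa> - 1)) = real \<kappa> * real (n choose \<kappa>)"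
  proof -
    obtain j where j: "\<kappa> = Suc j" using \<kappa> by (cases \<kappa>) auto
    have "n - \<kappa> + 1 = n - j" using j \<kappa> by simp
    moreover have "Suc j * (n choose Suc j) = (n - j) * (n choose j)"
      using binomial_absorb_comp[of n j] binomial_absorption[of j n] by simp
    ultimately have "(n - \<kappa> + 1) * (n choose (\<kappa> - 1)) = \<kappa> * (n choose \<kappa>)" using j by simp
    then show ?thesis by (simp only: flip: of_nat_mult)
  qed
  define E where "E = 2 * real D * real s ^ 3 / real (n - \<kappa> + 1)"
  have mean_le: "(\<Sum>(U, v)\<in>G. \<mu> U v) / real (card G) \<le> E"
  proof -
    have "(\<Sum>(U, v)\<in>G. \<mu> U v) * real (n - \<kappa> + 1)
        \<le> real D * real s ^ 3 * real (n choose (\<kappa> - 1)) * real (n - \<kappa> + 1)"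
      using \<mu>_sum by (intro mult_right_mono) auto
    also have "\<dots> = real D * real s ^ 3 * (real (n - \<kappa> + 1) * real (n choose (\<kappa> - 1)))"
      by (simp add: mult_ac)
    also have "\<dots> = real D * real s ^ 3 * real (\<kappa> * (n choose \<kappa>))"
      unfolding ch by simp
    also have "\<dots> \<le> real D * real s ^ 3 * real (2 * card G)"
      using G(2) by (intro mult_left_mono) (simp_all only: of_nat_le_iff, simp)
    finally have "(\<Sum>(U, v)\<in>G. \<mu> U v) * real (n - \<kappa> + 1) \<le> 2 * real D * real s ^ 3 * real (card G)"
      by simp
    then show ?thesis using G_pos unfolding E_def by (simp add: divide_simps mult_ac)
  qed
  have "real (card G) * exp (- ln 4 * E)
      \<le> real (card G) * exp (- ln 4 * ((\<Sum>(U, v)\<in>G. \<mu> U v) / real (card G)))"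
    using mult_left_mono[OF mean_le, of "ln 4"] G_pos by (intro mult_left_mono) auto
  also have "\<dots> \<le> (\<Sum>(U, v)\<in>G. exp (- ln 4 * \<mu> U v))"
    using exp_weighted_mean_le[of G "\<lambda>_. 1" "ln 4" "\<lambda>(U, v). \<mu> U v"] G_pos
    by (simp add: case_prod_unfold)
  also have "\<dots> \<le> (\<Sum>(U, v)\<in>G. 2 * occ U v)"
    using occ_ge by (intro sum_mono) force
  also have "\<dots> = 2 * (\<Sum>(U, v)\<in>G. occ U v)" by (simp add: sum_distrib_left case_prod_unfold)
  also have "\<dots> \<le> 2 * (real s * real (n choose \<kappa>))" using occ_sum by simp
  finally have 1: "real (card G) * exp (- ln 4 * E) \<le> 2 * (real s * real (n choose \<kappa>))" .
  \<comment> \<open>The factor 4 combines the halving in \<open>occ_ge\<close> with the fact that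
    \<open>G\<close> is only guaranteed to contain half of all pairs.\<close>
  have "real (n choose \<kappa>) * (real \<kappa> * exp (- ln 4 * E))
      = real (\<kappa> * (n choose \<kappa>)) * exp (- ln 4 * E)" by simp
  also have "\<dots> \<le> real (2 * card G) * exp (- ln 4 * E)"
    using G(2) by (intro mult_right_mono) (simp_all only: of_nat_le_iff, simp)
  also have "\<dots> = 2 * (real (card G) * exp (- ln 4 * E))" by simp
  also have "\<dots> \<le> 2 * (2 * (real s * real (n choose \<kappa>)))" using 1 by (intro mult_left_mono) auto
  also have "\<dots> = real (n choose \<kappa>) * (4 * real s)" by simp
  finally have "real (n choose \<kappa>) * (real \<kappa> * exp (- ln 4 * E)) \<le> real (n choose \<kappa>) * (4 * real s)" .
  then have "real \<kappa> * exp (- ln 4 * E) \<le> 4 * real s" using choose_pos by simp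
  then have "real \<kappa> * exp (- ln 4 * E) * exp (ln 4 * E) \<le> 4 * real s * exp (ln 4 * E)"
    by (intro mult_right_mono) auto
  then show ?thesis by (simp add: E_def mult.assoc flip: exp_add)
qed

section \<open>Short cycles in random vertex subsets\<close>

lemma card_nsets_containing:
  assumes V: "finite V" and F: "F \<subseteq> V"
  shows "card {U \<in> [V]\<^bsup>\<kappa>\<^esup>. F \<subseteq> U}
      = (if card F \<le> \<kappa> then (card V - card F) choose (\<kappa> - card F) else 0)"
proof (cases "card F \<le> \<kappa>")
  case True
  have finF: "finite F" using F V finite_subset by blast
  have "card {U \<in> [V]\<^bsup>\<kappa>\<^esup>. F \<subseteq> U} = card ([V - F]\<^bsup>(\<kappa> - card F)\<^esup>)"
  proof (rule bij_betw_same_card[of "\<lambda>U. U - F"], rule bij_betw_byWitness[where f' = "\<lambda>U. U \<union> F"])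
    show "(\<lambda>U. U - F) ` {U \<in> [V]\<^bsup>\<kappa>\<^esup>. F \<subseteq> U} \<subseteq> [V - F]\<^bsup>(\<kappa> - card F)\<^esup>"
      using finF by (auto simp: nsets_def card_Diff_subset)
    show "(\<lambda>U. U \<union> F) ` ([V - F]\<^bsup>(\<kappa> - card F)\<^esup>) \<subseteq> {U \<in> [V]\<^bsup>\<kappa>\<^esup>. F \<subseteq> U}"
    proof safe
      fix U assume "U \<in> [V - F]\<^bsup>(\<kappa> - card F)\<^esup>"
      then have U: "U \<subseteq> V" "finite U" "card U = \<kappa> - card F" "U \<inter> F = {}" by (auto simp: nsets_def)
      then have "card (U \<union> F) = \<kappa>" using finF True by (simp add: card_Un_disjoint)
      then show "U \<union> F \<in> [V]\<^bsup>\<kappa>\<^esup>" using U F finF by (auto simp: nsets_def)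
    qed
  qed (auto simp: nsets_def)
  also have "\<dots> = (card V - card F) choose (\<kappa> - card F)"
    using V F finF by (simp add: card_Diff_subset)
  finally show ?thesis using True by simp
next
  \<comment> \<open>Here \<open>\<kappa> - card F\<close> is truncated to 0 and the binomial
    coefficient would be 1 instead of 0, hence the case distinction.\<close>
  case False
  then have "{U \<in> [V]\<^bsup>\<kappa>\<^esup>. F \<subseteq> U} = {}" by (auto simp: nsets_def dest: card_mono)
  then show ?thesis using False by (simp only: card.empty if_False)
qed

text \<open>A fixed \<open>j\<close>-set lies in a random \<open>\<kappa>\<close>-set with
  probability the product of \<open>(\<kappa> - i) / (n - i)\<close> over \<open>i < j\<close>, and
  each factor is at most \<open>\<kappa> / n\<close>.\<close>

lemma choose_diff_le:
  assumes "j \<le> \<kappa>" "\<kappa> \<le> n" "0 < n"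
  shows "real ((n - j) choose (\<kappa> - j)) \<le> (real \<kappa> / real n) ^ j * real (n choose \<kappa>)"
  using assms
proof (induction j)
  case (Suc j)
  define a where "a = \<kappa> - Suc j"
  define m where "m = n - Suc j"
  have am: "\<kappa> - j = Suc a" "n - j = Suc m" using Suc.prems by (auto simp: a_def m_def)
  have "real (Suc a) * real (Suc m choose Suc a) = real (Suc m) * real (m choose a)"
    using Suc_times_binomial_eq[of m a] by (metis mult.commute of_nat_mult)
  then have "real (m choose a) = real (Suc a) / real (Suc m) * real (Suc m choose Suc a)"
    by (simp add: field_simps)
  also have "\<dots> \<le> real \<kappa> / real n * real (Suc m choose Suc a)"
  proof (intro mult_right_mono)
    have k: "real (Suc a) = real \<kappa> - real j" "real (Suc m) = real n - real j"
      using am Suc.prems by (auto simp flip: am)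
    have "(real \<kappa> - real j) * real n \<le> real \<kappa> * (real n - real j)"
      using Suc.prems mult_left_mono[of "real \<kappa>" "real n" "real j"] by (simp add: algebra_simps)
    then show "real (Suc a) / real (Suc m) \<le> real \<kappa> / real n"
      using Suc.prems unfolding k by (simp add: frac_le_eq divide_simps)
  qed auto
  also have "\<dots> \<le> real \<kappa> / real n * ((real \<kappa> / real n) ^ j * real (n choose \<kappa>))"
    using Suc by (intro mult_left_mono) (auto simp flip: am)
  finally show ?case by (simp add: a_def m_def)
qed simp

text \<open>Linearity of expectation, multiplied through by the number of samples: a configuration
  on \<open>j\<close> vertices survives with probability at most
  \<open>(\<kappa> / n) ^ j\<close>.\<close>

lemma sum_card_sampled_le:
  assumes V: "finite V" "card V = n" and \<kappa>: "\<kappa> \<le> n" "0 < n" and C: "finite C"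
    and F: "\<And>c. c \<in> C \<Longrightarrow> F c \<subseteq> V \<and> card (F c) = j"
  shows "real (\<Sum>U\<in>[V]\<^bsup>\<kappa>\<^esup>. card {c \<in> C. F c \<subseteq> U})
      \<le> real (card C) * (real \<kappa> / real n) ^ j * real (n choose \<kappa>)"
proof -
  have "(\<Sum>U\<in>[V]\<^bsup>\<kappa>\<^esup>. card {c \<in> C. F c \<subseteq> U}) = (\<Sum>c\<in>C. card {U \<in> [V]\<^bsup>\<kappa>\<^esup>. F c \<subseteq> U})"
    using V C by (intro sum_multicount_gen) (auto simp: finite_imp_finite_nsets)
  then have "real (\<Sum>U\<in>[V]\<^bsup>\<kappa>\<^esup>. card {c \<in> C. F c \<subseteq> U})
      = (\<Sum>c\<in>C. real (card {U \<in> [V]\<^bsup>\<kappa>\<^esup>. F c \<subseteq> U}))" by simp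
  also have "\<dots> \<le> (\<Sum>c\<in>C. (real \<kappa> / real n) ^ j * real (n choose \<kappa>))"
  proof (rule sum_mono)
    fix c assume "c \<in> C"
    then show "real (card {U \<in> [V]\<^bsup>\<kappa>\<^esup>. F c \<subseteq> U}) \<le> (real \<kappa> / real n) ^ j * real (n choose \<kappa>)"
      using F[of c] card_nsets_containing[of V "F c" \<kappa>] choose_diff_le[of j \<kappa> n] V \<kappa> by auto
  qed
  finally show ?thesis by simp
qed

section \<open>Short cycles in 4-uniform hypergraphs of bounded codegree\<close>

lemma card_edges_containing_le:
  assumes H: "H \<subseteq> [V]\<^bsup>4\<^esup>" and V: "finite V" "card V = n"
    and codeg: "\<And>S. S \<in> [V]\<^bsup>3\<^esup> \<Longrightarrow> card {e \<in> H. S \<subseteq> e} \<le> D"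
    and P: "P \<subseteq> V" "card P \<le> 3"
  shows "card {e \<in> H. P \<subseteq> e} \<le> n ^ (3 - card P) * D"
  using P
proof (induction "3 - card P" arbitrary: P)
  case 0
  then have "P \<in> [V]\<^bsup>3\<^esup>" using V finite_subset by (auto simp: nsets_def)
  then show ?case using codeg 0 by simp
next
  case (Suc i)
  have finH: "finite H" using H V finite_imp_finite_nsets finite_subset by blast
  have finP: "finite P" using Suc.prems V finite_subset by blast
  \<comment> \<open>An edge has four vertices and \<open>P\<close> fewer, so each edge counted
    contains a further vertex, for which there are at most \<open>n\<close> choices.\<close>
  have "{e \<in> H. P \<subseteq> e} \<subseteq> (\<Union>x\<in>V - P. {e \<in> H. insert x P \<subseteq> e})"
  proof
    fix e assume e: "e \<in> {e \<in> H. P \<subseteq> e}"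
    then have "e \<subseteq> V" "card e = 4" using H by (auto simp: nsets_def)
    moreover have "e \<noteq> P" using \<open>card e = 4\<close> Suc.prems by auto
    ultimately show "e \<in> (\<Union>x\<in>V - P. {e \<in> H. insert x P \<subseteq> e})" using e by blast
  qed
  then have "card {e \<in> H. P \<subseteq> e} \<le> card (\<Union>x\<in>V - P. {e \<in> H. insert x P \<subseteq> e})"
    using V finH by (intro card_mono) auto
  also have "\<dots> \<le> (\<Sum>x\<in>V - P. card {e \<in> H. insert x P \<subseteq> e})"
    using V by (intro card_UN_le) auto
  also have "\<dots> \<le> (\<Sum>x\<in>V - P. n ^ i * D)"
  proof (rule sum_mono)
    fix x assume x: "x \<in> V - P"
    then have c: "card (insert x P) = Suc (card P)" using finP by simp
    then have "i = 3 - card (insert x P)" using Suc.hyps(2) by simp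
    moreover have "card (insert x P) \<le> 3" using c Suc.hyps(2) by simp
    ultimately show "card {e \<in> H. insert x P \<subseteq> e} \<le> n ^ i * D"
      using Suc.hyps(1)[of "insert x P"] x Suc.prems by simp
  qed
  also have "\<dots> \<le> n * (n ^ i * D)" using V card_mono[of V "V - P"] by (auto intro: mult_right_mono)
  finally show ?case by (simp flip: Suc.hyps(2))
qed

text \<open>Two edges through \<open>v\<close> meet again, or a third edge \<open>h\<close> joins
  them. If some two of these edges share two vertices, they form a 2-cycle. Otherwise the three
  edges meet pairwise in single, distinct vertices and span \<open>4 + 3 + 2 = 9\<close>
  vertices.\<close>

lemma crowded_cases:
  assumes H: "H \<subseteq> [V]\<^bsup>4\<^esup>" and v: "v \<in> U" and crowded: "\<not> uncrowded H (U - {v}) v"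
  obtains
    (two_cycle) e e' where "e \<in> H" "e' \<in> H" "card (e \<inter> e') \<in> {2, 3}" "e \<union> e' \<subseteq> U" "v \<in> e"
  | (three_cycle) e e' h a b where "e \<in> H" "e' \<in> H" "h \<in> H" "v \<in> e" "v \<in> e'" "a \<in> e" "b \<in> e'"
      "a \<noteq> b" "a \<in> h" "b \<in> h" "e \<union> e' \<union> h \<subseteq> U" "card (e \<union> e' \<union> h) = 9"
proof -
  have fin: "finite e" "card e = 4" if "e \<in> H" for e using that H by (auto simp: nsets_def)
  have small: "card (e \<inter> e') < 4" if "e \<in> H" "e' \<in> H" "e \<noteq> e'" for e e'
  proof (rule ccontr)
    assume "\<not> card (e \<inter> e') < 4"
    then have "e \<inter> e' = e" using fin[OF that(1)] by (intro card_seteq) auto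
    moreover have "e \<inter> e' = e'" using fin[OF that(2)] \<open>\<not> card (e \<inter> e') < 4\<close> by (intro card_seteq) auto
    ultimately have "e = e'" by simp
    then show False using that by simp
  qed
  \<comment> \<open>Only the first edge is required to contain \<open>v\<close>, so that this also
    applies to \<open>h\<close> paired with \<open>e\<close> or \<open>e'\<close>.\<close>
  have cycle: "thesis" if "e \<in> H" "e' \<in> H" "e \<noteq> e'" "e \<union> e' \<subseteq> U" "v \<in> e" "x \<in> e \<inter> e'" "y \<in> e \<inter> e'" "x \<noteq> y"
    for e e' x y
  proof -
    have "card {x, y} \<le> card (e \<inter> e')" using that fin by (intro card_mono) auto
    then have "card (e \<inter> e') \<in> {2, 3}" using small[OF that(1-3)] that(8) by auto
    then show thesis using that two_cycle by blast
  qed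
  obtain f g where fg: "f \<in> link H v" "g \<in> link H v" "f \<subseteq> U - {v}" "g \<subseteq> U - {v}" "f \<noteq> g"
    and or: "f \<inter> g \<noteq> {} \<or> (\<exists>h\<in>H. h \<subseteq> U - {v} \<and> h \<inter> f \<noteq> {} \<and> h \<inter> g \<noteq> {})"
    using crowded unfolding uncrowded_def by blast
  define e e' where "e = insert v f" and "e' = insert v g"
  have e: "e \<in> H" "e' \<in> H" "v \<in> e" "v \<in> e'" "v \<notin> f" "v \<notin> g" using fg by (auto simp: e_def e'_def link_def)
  have ne: "e \<noteq> e'" using e fg unfolding e_def e'_def by blast
  have sub: "e \<union> e' \<subseteq> U" using fg v by (auto simp: e_def e'_def)
  show thesis
  proof (cases "f \<inter> g = {}")
    case False
    then obtain x where "x \<in> f" "x \<in> g" by auto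
    then show thesis using cycle[of e e' v x] e ne sub by (auto simp: e_def e'_def)
  next
    case True
    then obtain h where h: "h \<in> H" "h \<subseteq> U - {v}" "h \<inter> f \<noteq> {}" "h \<inter> g \<noteq> {}" using or by auto
    then obtain a b where ab: "a \<in> h" "a \<in> f" "b \<in> h" "b \<in> g" by auto
    then have "a \<noteq> b" using True by auto
    have hne: "h \<noteq> e" "h \<noteq> e'" using h e by auto
    show thesis
    proof (cases "h \<inter> f = {a} \<and> h \<inter> g = {b}")
      case False
      then consider x where "x \<in> h" "x \<in> f" "x \<noteq> a" | x where "x \<in> h" "x \<in> g" "x \<noteq> b" using ab by auto
      then show thesis
      proof cases
        case 1
        then show thesis using cycle[of e h x a] e hne h sub ab by (auto simp: e_def)
      next
        case 2
        then show thesis using cycle[of e' h x b] e hne h sub ab by (auto simp: e'_def)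
      qed
    next
      case hab: True
      have "e \<inter> e' = {v}" using True e by (auto simp: e_def e'_def)
      then have c7: "card (e \<union> e') = 7" using card_Un_Int[of e e'] fin e by simp
      have "(e \<union> e') \<inter> h = {a, b}" using hab h by (auto simp: e_def e'_def)
      then have "card (e \<union> e' \<union> h) = 9"
        using card_Un_Int[of "e \<union> e'" h] fin e h c7 \<open>a \<noteq> b\<close> by simp
      then show thesis
        using three_cycle[of e e' h a b] e h sub ab \<open>a \<noteq> b\<close> by (auto simp: e_def e'_def)
    qed
  qed
qed

lemma card_Sigma_le:
  fixes m k :: nat
  assumes "finite A" "card A \<le> m" "\<And>x. x \<in> A \<Longrightarrow> card (B x) \<le> k"
  shows "card (Sigma A B) \<le> m * k"
proof (cases "\<forall>x\<in>A. finite (B x)")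
  case True
  then have "card (Sigma A B) = (\<Sum>x\<in>A. card (B x))" using assms(1) by simp
  also have "\<dots> \<le> (\<Sum>x\<in>A. k)" using assms(3) by (intro sum_mono)
  also have "\<dots> \<le> m * k" using assms(2) by simp
  finally show ?thesis .
next
  \<comment> \<open>An infinite fibre makes the whole \<open>Sigma\<close> infinite, and its
    \<open>card\<close> is then 0 by convention.\<close>
  case False
  then obtain x where x: "x \<in> A" "infinite (B x)" by auto
  have "Pair x ` B x \<subseteq> Sigma A B" using x by auto
  moreover have "infinite (Pair x ` B x)" using x by (auto dest: finite_imageD simp: inj_on_def)
  ultimately have "infinite (Sigma A B)" using finite_subset by blast
  then show ?thesis by simp
qed

text \<open>First-moment method: there are of order \<open>n ^ (6 - i) * D ^ 2\<close> pairs of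
  edges with \<open>i\<close> common vertices, spanning \<open>8 - i\<close> vertices, and of order
  \<open>n ^ 6 * D ^ 3\<close> triangles, spanning 9. The constant 40 is
  \<open>4 * 6 + 4 * 4\<close>, from the choices of the common vertices in an edge and the four
  vertices that a pair can spoil.\<close>

lemma card_crowded_le:
  assumes H: "H \<subseteq> [V]\<^bsup>4\<^esup>" and V: "finite V" "card V = n"
    and codeg: "\<And>S. S \<in> [V]\<^bsup>3\<^esup> \<Longrightarrow> card {e \<in> H. S \<subseteq> e} \<le> D"
    and \<kappa>: "1 \<le> \<kappa>" "\<kappa> \<le> n"
  defines "\<rho> \<equiv> real D / real n"
  shows "real (card (SIGMA U:[V]\<^bsup>\<kappa>\<^esup>. {v \<in> U. \<not> uncrowded H (U - {v}) v}))
      \<le> (40 * real \<kappa> ^ 6 * \<rho> ^ 2 + 16 * real \<kappa> ^ 9 * \<rho> ^ 3) * real (n choose \<kappa>)"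
proof -
  have npos: "real n > 0" using \<kappa> by simp
  have finH: "finite H" using H V finite_imp_finite_nsets finite_subset by blast
  have H_fin: "finite e" "card e = 4" "e \<subseteq> V" if "e \<in> H" for e using that H by (auto simp: nsets_def)
  note deg = card_edges_containing_le[OF H V codeg]
  have cardH: "card H \<le> n ^ 3 * D" using deg[of "{}"] by simp
  define C2 where "C2 i = {(e, e') \<in> H \<times> H. card (e \<inter> e') = i}" for i :: nat
  have finC2: "finite (C2 i)" for i
    by (rule finite_subset[of _ "H \<times> H"]) (use finH in \<open>auto simp: C2_def\<close>)
  have cardC2: "card (C2 i) \<le> n ^ 3 * D * ((4 choose i) * (n ^ (3 - i) * D))" if "i \<le> 3" for i
  proof -
    have "C2 i \<subseteq> (\<Union>e\<in>H. \<Union>P\<in>[e]\<^bsup>i\<^esup>. {e} \<times> {e' \<in> H. P \<subseteq> e'})"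
    proof safe
      fix e e' assume "(e, e') \<in> C2 i"
      then have "e \<in> H" "e' \<in> H" "e \<inter> e' \<in> [e]\<^bsup>i\<^esup>"
        using H_fin(1) by (auto simp: C2_def nsets_def)
      then show "(e, e') \<in> (\<Union>e\<in>H. \<Union>P\<in>[e]\<^bsup>i\<^esup>. {e} \<times> {e' \<in> H. P \<subseteq> e'})" by blast
    qed
    then have "card (C2 i) \<le> card (\<Union>e\<in>H. \<Union>P\<in>[e]\<^bsup>i\<^esup>. {e} \<times> {e' \<in> H. P \<subseteq> e'})"
      using finH H_fin by (intro card_mono) (auto intro!: finite_imp_finite_nsets)
    also have "\<dots> \<le> (\<Sum>e\<in>H. card (\<Union>P\<in>[e]\<^bsup>i\<^esup>. {e} \<times> {e' \<in> H. P \<subseteq> e'}))"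
      using finH by (rule card_UN_le)
    also have "\<dots> \<le> (\<Sum>e\<in>H. (4 choose i) * (n ^ (3 - i) * D))"
    proof (rule sum_mono)
      fix e assume e: "e \<in> H"
      have "card (\<Union>P\<in>[e]\<^bsup>i\<^esup>. {e} \<times> {e' \<in> H. P \<subseteq> e'}) \<le> (\<Sum>P\<in>[e]\<^bsup>i\<^esup>. card ({e} \<times> {e' \<in> H. P \<subseteq> e'}))"
        using e H_fin by (intro card_UN_le finite_imp_finite_nsets)
      also have "\<dots> \<le> (\<Sum>P\<in>[e]\<^bsup>i\<^esup>. n ^ (3 - i) * D)"
      proof (rule sum_mono)
        fix P assume "P \<in> [e]\<^bsup>i\<^esup>"
        then show "card ({e} \<times> {e' \<in> H. P \<subseteq> e'}) \<le> n ^ (3 - i) * D"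
          using deg[of P] that H_fin(3)[OF e] by (auto simp: nsets_def card_cartesian_product)
      qed
      also have "\<dots> = (4 choose i) * (n ^ (3 - i) * D)" using H_fin[OF e] by simp
      finally show "card (\<Union>P\<in>[e]\<^bsup>i\<^esup>. {e} \<times> {e' \<in> H. P \<subseteq> e'}) \<le> \<dots>" .
    qed
    also have "\<dots> \<le> n ^ 3 * D * ((4 choose i) * (n ^ (3 - i) * D))"
      using cardH by (simp only: sum_constant of_nat_id) (rule mult_right_mono, auto)
    finally show ?thesis .
  qed
  have unionC2: "fst c \<union> snd c \<subseteq> V \<and> card (fst c \<union> snd c) = 8 - i" if "c \<in> C2 i" for c i
  proof -
    obtain e e' where c: "c = (e, e')" "e \<in> H" "e' \<in> H" "card (e \<inter> e') = i"
      using \<open>c \<in> C2 i\<close> by (auto simp: C2_def)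
    then show ?thesis
      using card_Un_Int[of e e'] H_fin(1,2)[of e] H_fin(1,2)[of e'] H_fin(3)[of e] H_fin(3)[of e'] by simp
  qed
  \<comment> \<open>\<open>p\<close> records where \<open>h\<close> is attached to \<open>e\<close>
    and \<open>e'\<close>, so that \<open>h\<close> is counted through two known vertices:
    \<open>n\<close> choices for \<open>v\<close>, \<open>n ^ 2 * D\<close> for each of
    \<open>e\<close> and \<open>e'\<close>, 16 for \<open>p\<close>, and \<open>n * D\<close> for
    \<open>h\<close>. \<open>C3\<close> then forgets \<open>p\<close>.\<close>
  define T where "T = (SIGMA v:V. SIGMA e:{e \<in> H. {v} \<subseteq> e}. SIGMA e':{e \<in> H. {v} \<subseteq> e}.
      SIGMA p:{(a, b) \<in> e \<times> e'. a \<noteq> b}. {h \<in> H. {fst p, snd p} \<subseteq> h})"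
  define C3 where "C3 = (\<lambda>(v, e, e', p, h). (v, e, e', h)) ` {(v, e, e', p, h) \<in> T. card (e \<union> e' \<union> h) = 9}"
  have finT: "finite T"
    unfolding T_def using V finH H_fin
    by (intro finite_SigmaI) (auto intro: finite_subset[of _ "_ \<times> _"])
  have finC3: "finite C3" unfolding C3_def
    by (intro finite_imageI finite_subset[OF _ finT]) auto
  have cardT: "card T \<le> n * (n ^ 2 * D * (n ^ 2 * D * (16 * (n * D))))"
    unfolding T_def
  proof (intro card_Sigma_le)
    fix v e e' p
    assume "v \<in> V" and e: "e \<in> {e \<in> H. {v} \<subseteq> e}" and e': "e' \<in> {e \<in> H. {v} \<subseteq> e}"
      and p: "p \<in> {(a, b) \<in> e \<times> e'. a \<noteq> b}"
    have "{fst p, snd p} \<subseteq> V" using p e e' H_fin(3)[of e] H_fin(3)[of e'] by auto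
    then show "card {h \<in> H. {fst p, snd p} \<subseteq> h} \<le> n * D"
      using deg[of "{fst p, snd p}"] p by auto
  next
    fix v e e' assume e: "e \<in> {e \<in> H. {v} \<subseteq> e}" and e': "e' \<in> {e \<in> H. {v} \<subseteq> e}"
    then have "card {(a, b) \<in> e \<times> e'. a \<noteq> b} \<le> card (e \<times> e')"
      using H_fin by (intro card_mono) auto
    then show "card {(a, b) \<in> e \<times> e'. a \<noteq> b} \<le> 16"
      using e e' H_fin by (simp add: card_cartesian_product)
    show "finite {(a, b) \<in> e \<times> e'. a \<noteq> b}"
      by (rule finite_subset[of _ "e \<times> e'"]) (use e e' H_fin in auto)
  qed (use V finH deg[of "{_}"] in auto)
  have "card C3 \<le> card {(v, e, e', p, h) \<in> T. card (e \<union> e' \<union> h) = 9}"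
    unfolding C3_def by (intro card_image_le finite_subset[OF _ finT]) auto
  also have "\<dots> \<le> card T" using finT by (intro card_mono) auto
  also note cardT
  finally have cardC3: "card C3 \<le> 16 * n ^ 6 * D ^ 3" by (simp add: algebra_simps power_numeral_reduce)
  define F3 where "F3 = (\<lambda>(v :: 'a, e, e', h). e \<union> e' \<union> h :: 'a set)"
  have unionC3: "F3 c \<subseteq> V \<and> card (F3 c) = 9" if "c \<in> C3" for c
  proof -
    obtain v e e' p h where c: "c = (v, e, e', h)" "(v, e, e', p, h) \<in> T" "card (e \<union> e' \<union> h) = 9"
      using \<open>c \<in> C3\<close> by (auto simp: C3_def)
    then have "e \<in> H" "e' \<in> H" "h \<in> H" by (auto simp: T_def)
    then show ?thesis using c H_fin(3) by (simp add: F3_def)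
  qed
  define A where "A i U = {c \<in> C2 i. fst c \<union> snd c \<subseteq> U}" for i U
  define A3 where "A3 U = {c \<in> C3. F3 c \<subseteq> U}" for U
  have finA: "finite (A i U)" "finite (A3 U)" for i U using finC2 finC3 by (auto simp: A_def A3_def)
  \<comment> \<open>A 2-cycle is an ordered pair and is charged only with the four vertices of its
    first edge; a triangle is recorded together with \<open>v\<close> and is charged with this one
    vertex.\<close>
  have bad: "card {v \<in> U. \<not> uncrowded H (U - {v}) v} \<le> 4 * card (A 2 U) + 4 * card (A 3 U) + card (A3 U)"
    if U: "U \<in> [V]\<^bsup>\<kappa>\<^esup>" for U
  proof -
    have "{v \<in> U. \<not> uncrowded H (U - {v}) v} \<subseteq> (\<Union>c\<in>A 2 U. fst c) \<union> (\<Union>c\<in>A 3 U. fst c) \<union> fst ` A3 U"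
    proof safe
      fix v assume v: "v \<in> U" "\<not> uncrowded H (U - {v}) v" "v \<notin> fst ` A3 U" "v \<notin> (\<Union>c\<in>A 3 U. fst c)"
      show "v \<in> (\<Union>c\<in>A 2 U. fst c)"
      proof (cases rule: crowded_cases[OF H v(1,2)])
        case (1 e e')
        then have "(e, e') \<in> A 2 U \<union> A 3 U" by (auto simp: A_def C2_def)
        then show ?thesis using v(4) 1(5) by force
      next
        case (2 e e' h a b)
        have "v \<in> V" using U v(1) by (auto simp: nsets_def)
        then have "(v, e, e', (a, b), h) \<in> T" using 2 by (simp add: T_def)
        then have "(v, e, e', h) \<in> C3"
          unfolding C3_def using 2(12) by (intro rev_image_eqI[of "(v, e, e', (a, b), h)"]) auto
        then have "(v, e, e', h) \<in> A3 U" using 2(11) by (simp add: A3_def F3_def)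
        then show ?thesis using v(3) by force
      qed
    qed
    then have "card {v \<in> U. \<not> uncrowded H (U - {v}) v}
        \<le> card ((\<Union>c\<in>A 2 U. fst c) \<union> (\<Union>c\<in>A 3 U. fst c) \<union> fst ` A3 U)"
      using finA H_fin by (intro card_mono) (auto simp: A_def C2_def)
    also have "\<dots> \<le> card (\<Union>c\<in>A 2 U. fst c) + card (\<Union>c\<in>A 3 U. fst c) + card (fst ` A3 U)"
      by (meson add_le_mono1 card_Un_le le_trans)
    also have "\<dots> \<le> 4 * card (A 2 U) + 4 * card (A 3 U) + card (A3 U)"
    proof (intro add_mono)
      have "card (\<Union>c\<in>A i U. fst c) \<le> 4 * card (A i U)" for i
      proof -
        have "card (\<Union>c\<in>A i U. fst c) \<le> (\<Sum>c\<in>A i U. card (fst c))" using finA by (intro card_UN_le)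
        also have "\<dots> = (\<Sum>c\<in>A i U. 4)" using H_fin by (intro sum.cong) (auto simp: A_def C2_def)
        finally show ?thesis by simp
      qed
      then show "card (\<Union>c\<in>A 2 U. fst c) \<le> 4 * card (A 2 U)" "card (\<Union>c\<in>A 3 U. fst c) \<le> 4 * card (A 3 U)"
        by blast+
      show "card (fst ` A3 U) \<le> card (A3 U)" using finA by (intro card_image_le)
    qed
    finally show ?thesis .
  qed
  let ?N = "real (n choose \<kappa>)" and ?P = "[V]\<^bsup>\<kappa>\<^esup>"
  have finP: "finite ?P" using V by (simp add: finite_imp_finite_nsets)
  have sum2: "real (\<Sum>U\<in>?P. card (A i U)) \<le> real (card (C2 i)) * (real \<kappa> / real n) ^ (8 - i) * ?N" for i
    unfolding A_def using V \<kappa> finC2 unionC2 by (intro sum_card_sampled_le) auto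
  have sum3: "real (\<Sum>U\<in>?P. card (A3 U)) \<le> real (card C3) * (real \<kappa> / real n) ^ 9 * ?N"
    unfolding A3_def using V \<kappa> finC3 unionC3 by (intro sum_card_sampled_le) auto
  have "(\<Sum>U\<in>?P. card (A 2 U)) \<le> 6 * real \<kappa> ^ 6 * \<rho> ^ 2 * ?N"
  proof -
    note sum2[of 2]
    also have "real (card (C2 2)) \<le> real (n ^ 3 * D * ((4 choose 2) * (n ^ 1 * D)))"
      using cardC2[of 2] by (simp only: of_nat_le_iff) simp
    also have "\<dots> = 6 * real n ^ 4 * real D ^ 2"
      by (simp add: binomial_fact_lemma numeral_eq_Suc)
    also have "6 * real n ^ 4 * real D ^ 2 * (real \<kappa> / real n) ^ (8 - 2) = 6 * real \<kappa> ^ 6 * \<rho> ^ 2"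
      using npos by (simp add: \<rho>_def field_simps flip: power_add)
    finally show ?thesis by (simp add: mult_right_mono)
  qed
  moreover have "(\<Sum>U\<in>?P. card (A 3 U)) \<le> 4 * real \<kappa> ^ 6 * \<rho> ^ 2 * ?N"
  proof -
    note sum2[of 3]
    also have "real (card (C2 3)) \<le> real (n ^ 3 * D * ((4 choose 3) * (n ^ 0 * D)))"
      using cardC2[of 3] by (simp only: of_nat_le_iff) simp
    also have "\<dots> = 4 * real n ^ 3 * real D ^ 2"
      by (simp add: numeral_eq_Suc)
    also have "4 * real n ^ 3 * real D ^ 2 * (real \<kappa> / real n) ^ (8 - 3) = 4 * real \<kappa> ^ 5 * \<rho> ^ 2"
      using npos by (simp add: \<rho>_def field_simps flip: power_add)
    \<comment> \<open>Three common vertices give only the fifth power of \<open>\<kappa>\<close>;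
      \<open>1 \<le> \<kappa>\<close> allows this term to be merged with that for two common
      vertices.\<close>
    also have "\<dots> \<le> 4 * real \<kappa> ^ 6 * \<rho> ^ 2" using \<kappa>
      by (intro mult_right_mono mult_left_mono power_increasing) auto
    finally show ?thesis by (simp add: mult_right_mono)
  qed
  moreover have "(\<Sum>U\<in>?P. card (A3 U)) \<le> 16 * real \<kappa> ^ 9 * \<rho> ^ 3 * ?N"
  proof -
    note sum3
    also have "real (card C3) \<le> real (16 * n ^ 6 * D ^ 3)" using cardC3 by (simp only: of_nat_le_iff)
    also have "\<dots> = 16 * real n ^ 6 * real D ^ 3" by simp
    also have "16 * real n ^ 6 * real D ^ 3 * (real \<kappa> / real n) ^ 9 = 16 * real \<kappa> ^ 9 * \<rho> ^ 3"
      using npos by (simp add: \<rho>_def field_simps flip: power_add)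
    finally show ?thesis by (simp add: mult_right_mono)
  qed
  moreover have "real (card (SIGMA U:?P. {v \<in> U. \<not> uncrowded H (U - {v}) v}))
      \<le> real (4 * (\<Sum>U\<in>?P. card (A 2 U)) + 4 * (\<Sum>U\<in>?P. card (A 3 U)) + (\<Sum>U\<in>?P. card (A3 U)))"
  proof -
    have "card (SIGMA U:?P. {v \<in> U. \<not> uncrowded H (U - {v}) v})
        = (\<Sum>U\<in>?P. card {v \<in> U. \<not> uncrowded H (U - {v}) v})"
      using finP by (subst card_SigmaI) (auto simp: nsets_def)
    also have "\<dots> \<le> (\<Sum>U\<in>?P. 4 * card (A 2 U) + 4 * card (A 3 U) + card (A3 U))"
      by (intro sum_mono bad)
    finally show ?thesis by (simp only: of_nat_le_iff sum.distrib sum_distrib_left)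
  qed
  ultimately show ?thesis by (simp add: algebra_simps)
qed

section \<open>Rainbow cliques in colorings of bounded color degree\<close>

definition color_nbrs :: "('a set \<Rightarrow> nat) \<Rightarrow> 'a set \<Rightarrow> 'a \<Rightarrow> nat \<Rightarrow> 'a set" where
  "color_nbrs \<chi> V v c = {w \<in> V. w \<noteq> v \<and> \<chi> {v, w} = c}"

text \<open>\<open>e\<close> and \<open>X - e\<close> are the two edges of a perfect matching of the
  four vertices.\<close>

definition disjoint_conflicts :: "('a set \<Rightarrow> nat) \<Rightarrow> 'a set \<Rightarrow> 'a set set" where
  "disjoint_conflicts \<chi> V = {X \<in> [V]\<^bsup>4\<^esup>. \<exists>e\<in>[X]\<^bsup>2\<^esup>. \<chi> e = \<chi> (X - e)}"

text \<open>Ordered triples with the common vertex of the two edges first, so that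
  \<open>fst\<close> yields the vertex to be deleted.\<close>

definition adjacent_conflicts :: "('a set \<Rightarrow> nat) \<Rightarrow> 'a set \<Rightarrow> ('a \<times> 'a \<times> 'a) set" where
  "adjacent_conflicts \<chi> V =
     {(v, a, b). v \<in> V \<and> a \<in> V \<and> b \<in> V \<and> v \<noteq> a \<and> v \<noteq> b \<and> a \<noteq> b \<and> \<chi> {v, a} = \<chi> {v, b}}"

lemma rainbow_clique_subset: "rainbow_clique \<chi> S \<Longrightarrow> T \<subseteq> S \<Longrightarrow> rainbow_clique \<chi> T"
  using nsets_mono[of T S 2] unfolding rainbow_clique_def by blast

lemma rainbow_clique_subset_card:
  assumes "rainbow_clique \<chi> S" "S \<subseteq> V" "r \<le> card S"
  shows "\<exists>T\<subseteq>V. card T = r \<and> rainbow_clique \<chi> T"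
proof -
  obtain T where "T \<subseteq> S" "card T = r" using obtain_subset_with_card_n[OF assms(3)] by blast
  then show ?thesis using rainbow_clique_subset[OF assms(1)] assms(2) by blast
qed

text \<open>A conflict that contains \<open>S\<close> has one further vertex \<open>x\<close>. It is
  joined to some \<open>y \<in> S\<close> in the color of the opposite edge \<open>S - {y}\<close>,
  which leaves 3 choices for \<open>y\<close> and then at most \<open>d\<close> for
  \<open>x\<close>.\<close>

lemma disjoint_conflicts_codegree:
  assumes V: "finite V" and deg: "\<And>v c. v \<in> V \<Longrightarrow> card (color_nbrs \<chi> V v c) \<le> d"
    and S: "S \<in> [V]\<^bsup>3\<^esup>"
  shows "card {X \<in> disjoint_conflicts \<chi> V. S \<subseteq> X} \<le> 3 * d"
proof -
  have S': "S \<subseteq> V" "finite S" "card S = 3" using S by (auto simp: nsets_def)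
  have fin: "finite (color_nbrs \<chi> V v c)" for v c using V by (simp add: color_nbrs_def)
  have "{X \<in> disjoint_conflicts \<chi> V. S \<subseteq> X}
      \<subseteq> (\<Union>y\<in>S. (\<lambda>x. insert x S) ` color_nbrs \<chi> V y (\<chi> (S - {y})))"
  proof
    fix X assume "X \<in> {X \<in> disjoint_conflicts \<chi> V. S \<subseteq> X}"
    then obtain e where X: "X \<subseteq> V" "finite X" "card X = 4" "S \<subseteq> X"
      and e: "e \<subseteq> X" "card e = 2" "\<chi> e = \<chi> (X - e)"
      by (auto simp: disjoint_conflicts_def nsets_def)
    have "card (X - S) = 1" using X S' by (simp add: card_Diff_subset)
    then obtain x where x: "X - S = {x}" by (auto simp: card_1_singleton_iff)
    have xX: "X = insert x S" "x \<notin> S" using x X by auto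
    \<comment> \<open>Of the two edges of the matching, \<open>e'\<close> is the one that contains
      the new vertex \<open>x\<close>.\<close>
    define e' where "e' = (if x \<in> e then e else X - e)"
    have e': "e' \<subseteq> X" "card e' = 2" "\<chi> e' = \<chi> (X - e')" "x \<in> e'"
    proof -
      have "X - (X - e) = e" "finite e" "x \<in> X" using e(1) X(2) x finite_subset by auto
      then show "e' \<subseteq> X" "card e' = 2" "\<chi> e' = \<chi> (X - e')" "x \<in> e'"
        using e X(3) by (auto simp: e'_def card_Diff_subset)
    qed
    then have "card (e' - {x}) = 1" by (simp add: card_Diff_singleton)
    then obtain y where y: "e' - {x} = {y}" by (auto simp: card_1_singleton_iff)
    then have e'_eq: "e' = {y, x}" and "y \<noteq> x" "y \<in> S" using e' xX by auto
    have "X - e' = S - {y}" using e'_eq xX by auto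
    then have "x \<in> color_nbrs \<chi> V y (\<chi> (S - {y}))"
      using e' e'_eq X xX \<open>y \<noteq> x\<close> by (auto simp: color_nbrs_def)
    then show "X \<in> (\<Union>y\<in>S. (\<lambda>x. insert x S) ` color_nbrs \<chi> V y (\<chi> (S - {y})))"
      using xX(1) \<open>y \<in> S\<close> by blast
  qed
  then have "card {X \<in> disjoint_conflicts \<chi> V. S \<subseteq> X}
      \<le> card (\<Union>y\<in>S. (\<lambda>x. insert x S) ` color_nbrs \<chi> V y (\<chi> (S - {y})))"
    using S' fin by (intro card_mono) auto
  also have "\<dots> \<le> (\<Sum>y\<in>S. card ((\<lambda>x. insert x S) ` color_nbrs \<chi> V y (\<chi> (S - {y}))))"
    using S' by (intro card_UN_le)
  also have "\<dots> \<le> (\<Sum>y\<in>S. d)"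
    using S' fin deg by (intro sum_mono) (meson card_image_le le_trans subsetD)
  finally show ?thesis using S' by simp
qed

lemma card_adjacent_conflicts_le:
  assumes V: "finite V" and deg: "\<And>v c. v \<in> V \<Longrightarrow> card (color_nbrs \<chi> V v c) \<le> d"
  shows "finite (adjacent_conflicts \<chi> V)" "card (adjacent_conflicts \<chi> V) \<le> card V * (card V * d)"
proof -
  let ?S = "SIGMA v:V. SIGMA a:V. color_nbrs \<chi> V v (\<chi> {v, a})"
  have sub: "adjacent_conflicts \<chi> V \<subseteq> ?S" by (auto simp: adjacent_conflicts_def color_nbrs_def)
  have fin: "finite ?S" using V by (auto simp: color_nbrs_def)
  show "finite (adjacent_conflicts \<chi> V)" by (rule finite_subset[OF sub fin])
  have "card (adjacent_conflicts \<chi> V) \<le> card ?S" by (rule card_mono[OF fin sub])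
  also have "\<dots> \<le> card V * (card V * d)" using V deg by (intro card_Sigma_le) auto
  finally show "card (adjacent_conflicts \<chi> V) \<le> card V * (card V * d)" .
qed

text \<open>Two disjoint edges of equal color would form a conflict inside the independent set
  \<open>W\<close>; if they share a vertex, then it is the centre of an adjacent conflict and has
  been removed.\<close>

lemma rainbow_clique_remove_centres:
  assumes W: "W \<in> indep_sets (disjoint_conflicts \<chi> V) U" and U: "U \<subseteq> V"
  shows "rainbow_clique \<chi> (W - fst ` adjacent_conflicts \<chi> U)"
  unfolding rainbow_clique_def
proof (intro ballI impI notI)
  fix e f
  assume e: "e \<in> [W - fst ` adjacent_conflicts \<chi> U]\<^bsup>2\<^esup>" and f: "f \<in> [W - fst ` adjacent_conflicts \<chi> U]\<^bsup>2\<^esup>"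
    and ne: "e \<noteq> f" and eq: "\<chi> e = \<chi> f"
  have WU: "W \<subseteq> U" using W by (auto simp: indep_sets_def)
  show False
  proof (cases "e \<inter> f = {}")
    case True
    have ef: "e \<union> f \<subseteq> W" "finite e" "finite f" "card e = 2" "card f = 2" using e f by (auto simp: nsets_def)
    then have "e \<union> f \<in> [V]\<^bsup>4\<^esup>" using True WU U by (auto simp: nsets_def card_Un_disjoint)
    moreover have "e \<union> f - e = f" "e \<in> [e \<union> f]\<^bsup>2\<^esup>" using True ef by (auto simp: nsets_def)
    ultimately have "e \<union> f \<in> disjoint_conflicts \<chi> V"
      using eq unfolding disjoint_conflicts_def by (auto intro!: bexI[of _ e])
    then show False using W ef(1) by (auto simp: indep_sets_def)
  next
    case False
    then obtain v where v: "v \<in> e" "v \<in> f" by auto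
    obtain a where a: "e = {v, a}" "v \<noteq> a" using e v(1) by (auto elim!: nsets2_E)
    obtain b where b: "f = {v, b}" "v \<noteq> b" using f v(2) by (auto elim!: nsets2_E)
    have sub: "{v, a, b} \<subseteq> W - fst ` adjacent_conflicts \<chi> U" using e f a b by (auto simp: nsets_def)
    then have "(v, a, b) \<in> adjacent_conflicts \<chi> U"
      using a b ne eq WU by (auto simp: adjacent_conflicts_def)
    then show False using sub by force
  qed
qed

text \<open>The hypergraph bound with \<open>D = 3 * d\<close> and \<open>s = 2 * r\<close>: if
  \<open>U\<close> has at most \<open>r\<close> adjacent conflicts, then deleting their centres
  turns an independent set into a rainbow one, which has fewer than \<open>r\<close> vertices.
  \<open>small\<close> says that a random pair \<open>(U, v)\<close> fails with probability at most
  1/2; its first term concerns adjacent conflicts, the other two short cycles.\<close>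

lemma sample_size_le_of_no_rainbow_clique:
  assumes V: "finite V" "card V = n" and deg: "\<And>v c. v \<in> V \<Longrightarrow> card (color_nbrs \<chi> V v c) \<le> d"
    and no_rainbow: "\<And>S. S \<subseteq> V \<Longrightarrow> card S = r \<Longrightarrow> \<not> rainbow_clique \<chi> S"
    and \<kappa>: "1 \<le> \<kappa>" "\<kappa> \<le> n" and r: "1 \<le> r"
  defines "\<rho> \<equiv> real (3 * d) / real n"
  assumes small: "real \<kappa> ^ 3 * \<rho> / real r + 40 * real \<kappa> ^ 5 * \<rho> ^ 2 + 16 * real \<kappa> ^ 8 * \<rho> ^ 3 \<le> 1 / 2"
  shows "real \<kappa> \<le> 8 * real r * exp (ln 4 * (48 * real d * real r ^ 3 / real (n - \<kappa> + 1)))"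
proof -
  define H where "H = disjoint_conflicts \<chi> V"
  define T where "T U = card (adjacent_conflicts \<chi> U)" for U
  have H: "H \<subseteq> [V]\<^bsup>4\<^esup>" by (auto simp: H_def disjoint_conflicts_def)
  have codeg: "card {e \<in> H. S \<subseteq> e} \<le> 3 * d" if "S \<in> [V]\<^bsup>3\<^esup>" for S
    unfolding H_def using disjoint_conflicts_codegree[OF V(1) deg that] .
  let ?P = "[V]\<^bsup>\<kappa>\<^esup>" and ?N = "real (n choose \<kappa>)"
  have finP: "finite ?P" and cardP: "card ?P = n choose \<kappa>" using V by (simp_all add: finite_imp_finite_nsets)
  define G where "G = {(U, v) \<in> (SIGMA U:?P. U). T U \<le> r \<and> uncrowded H (U - {v}) v}"
  define B where "B = (SIGMA U:?P. {v \<in> U. \<not> uncrowded H (U - {v}) v})"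
  define B' where "B' = (SIGMA U:{U \<in> ?P. r < T U}. U)"
  have U_fin: "finite U" "card U = \<kappa>" "U \<subseteq> V" if "U \<in> ?P" for U using that by (auto simp: nsets_def)
  have fin_all: "finite (SIGMA U:?P. U)" using finP U_fin by auto
  have card_all: "card (SIGMA U:?P. U) = (n choose \<kappa>) * \<kappa>"
    using finP U_fin cardP by (subst card_SigmaI) auto
  have finG: "finite G" by (rule finite_subset[OF _ fin_all]) (auto simp: G_def)
  have finB: "finite B" by (rule finite_subset[OF _ fin_all]) (auto simp: B_def)
  have finB': "finite B'" by (rule finite_subset[OF _ fin_all]) (auto simp: B'_def)
  have "(SIGMA U:?P. U) \<subseteq> G \<union> B \<union> B'" by (auto simp: G_def B_def B'_def)
  then have "card (SIGMA U:?P. U) \<le> card (G \<union> B \<union> B')"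
    using finG finB finB' by (intro card_mono) auto
  also have "\<dots> \<le> card G + card B + card B'"
    by (meson add_le_mono1 card_Un_le le_trans)
  finally have cover: "real \<kappa> * ?N \<le> real (card G) + real (card B) + real (card B')"
    unfolding card_all by (simp flip: of_nat_mult of_nat_add add: mult.commute)
  have boundB: "real (card B) \<le> (40 * real \<kappa> ^ 6 * \<rho> ^ 2 + 16 * real \<kappa> ^ 9 * \<rho> ^ 3) * ?N"
    unfolding B_def \<rho>_def by (rule card_crowded_le[OF H V codeg \<kappa>])
  \<comment> \<open>Markov's inequality: the expected number of adjacent conflicts in a sample is at
    most \<open>\<kappa> ^ 3 * \<rho> / 3\<close>.\<close>
  have boundB': "real (card B') \<le> real \<kappa> * (real \<kappa> ^ 3 * \<rho> / real r) * ?N"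
  proof -
    let ?F = "\<lambda>(v, a, b). {v, a, b}"
    have T_eq: "T U = card {c \<in> adjacent_conflicts \<chi> V. ?F c \<subseteq> U}" if "U \<in> ?P" for U
      unfolding T_def adjacent_conflicts_def using U_fin(3)[OF that]
      by (intro arg_cong[of _ _ card]) auto
    have "r * card {U \<in> ?P. r < T U} \<le> (\<Sum>U\<in>{U \<in> ?P. r < T U}. T U)"
      using sum_bounded_below[of "{U \<in> ?P. r < T U}" r T] by (simp add: mult.commute)
    also have "\<dots> \<le> (\<Sum>U\<in>?P. T U)" using finP by (intro sum_mono2) auto
    also have "\<dots> = (\<Sum>U\<in>?P. card {c \<in> adjacent_conflicts \<chi> V. ?F c \<subseteq> U})"
      using T_eq by (intro sum.cong) auto
    finally have "real r * real (card {U \<in> ?P. r < T U})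
        \<le> real (\<Sum>U\<in>?P. card {c \<in> adjacent_conflicts \<chi> V. ?F c \<subseteq> U})"
      by (simp only: of_nat_le_iff flip: of_nat_mult)
    also have "\<dots> \<le> real (card (adjacent_conflicts \<chi> V)) * (real \<kappa> / real n) ^ 3 * ?N"
      using V \<kappa> card_adjacent_conflicts_le(1)[OF V(1) deg]
      by (intro sum_card_sampled_le) (auto simp: adjacent_conflicts_def)
    also have "\<dots> \<le> real (n * (n * d)) * (real \<kappa> / real n) ^ 3 * ?N"
      using card_adjacent_conflicts_le(2)[OF V(1) deg] V(2)
      by (intro mult_right_mono) (simp_all only: of_nat_le_iff, simp_all)
    also have "real (n * (n * d)) * (real \<kappa> / real n) ^ 3 = real \<kappa> ^ 3 * (\<rho> / 3)"
      using \<kappa> by (simp add: \<rho>_def field_simps power3_eq_cube)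
    also have "real \<kappa> ^ 3 * (\<rho> / 3) * ?N \<le> real \<kappa> ^ 3 * \<rho> * ?N"
      by (intro mult_right_mono mult_left_mono) (auto simp: \<rho>_def intro!: divide_right_mono)
    finally have "real (card {U \<in> ?P. r < T U}) \<le> real \<kappa> ^ 3 * \<rho> * ?N / real r"
      using r by (simp add: pos_le_divide_eq mult.commute)
    moreover have "card B' = card {U \<in> ?P. r < T U} * \<kappa>"
      unfolding B'_def using finP U_fin by (subst card_SigmaI) auto
    ultimately show ?thesis
      using mult_left_mono[of "real (card {U \<in> ?P. r < T U})" "real \<kappa> ^ 3 * \<rho> * ?N / real r" "real \<kappa>"]
      by (simp add: mult_ac)
  qed
  have "real (card B) + real (card B')
      \<le> real \<kappa> * ?N * (real \<kappa> ^ 3 * \<rho> / real r + 40 * real \<kappa> ^ 5 * \<rho> ^ 2 + 16 * real \<kappa> ^ 8 * \<rho> ^ 3)"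
    using boundB boundB' by (simp add: algebra_simps power_numeral_reduce)
  also have "\<dots> \<le> real \<kappa> * ?N * (1 / 2)" using small by (intro mult_left_mono) auto
  finally have "real (\<kappa> * (n choose \<kappa>)) \<le> real (2 * card G)" using cover by simp
  then have G_big: "\<kappa> * (n choose \<kappa>) \<le> 2 * card G" by (simp only: of_nat_le_iff)
  have alpha: "card W \<le> 2 * r" if "(U, v) \<in> G" "W \<in> indep_sets H U" for U v W
  proof -
    have U: "U \<subseteq> V" "finite U" "T U \<le> r" using that(1) U_fin by (auto simp: G_def)
    have finA: "finite (adjacent_conflicts \<chi> U)"
      by (rule finite_subset[of _ "U \<times> U \<times> U"]) (use U in \<open>auto simp: adjacent_conflicts_def\<close>)
    let ?W = "W - fst ` adjacent_conflicts \<chi> U"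
    have WU: "W \<subseteq> U" using that(2) by (auto simp: indep_sets_def)
    have "rainbow_clique \<chi> ?W"
      using rainbow_clique_remove_centres that(2) U(1) unfolding H_def by blast
    moreover have "?W \<subseteq> V" using WU U by auto
    ultimately have "card ?W < r"
      using rainbow_clique_subset_card[of \<chi> ?W V r] no_rainbow by (meson not_le)
    moreover have "card W - card (fst ` adjacent_conflicts \<chi> U) \<le> card ?W"
      using finA by (intro diff_card_le_card_Diff) auto
    moreover have "card (fst ` adjacent_conflicts \<chi> U) \<le> r"
      using card_image_le[OF finA, of fst] U(3) by (simp add: T_def)
    ultimately show ?thesis by simp
  qed
  have "real \<kappa> \<le> 4 * real (2 * r) * exp (ln 4 * (2 * real (3 * d) * real (2 * r) ^ 3 / real (n - \<kappa> + 1)))"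
  proof (rule sample_size_le_independence_number[OF V H codeg \<kappa> _ G_big])
    show "G \<subseteq> (SIGMA U:?P. U)" by (auto simp: G_def)
    show "uncrowded H (U - {v}) v" if "(U, v) \<in> G" for U v using that by (auto simp: G_def)
  qed (use alpha in auto)
  also have "2 * real (3 * d) * real (2 * r) ^ 3 = 48 * real d * real r ^ 3"
    by (simp add: power_mult_distrib)
  finally show ?thesis by simp
qed

section \<open>Choice of parameters\<close>

lemma cube_div_ln_ge:
  assumes "3 \<le> (r::nat)"
  shows "0 < ln (real r)" "real r ^ 2 \<le> real r ^ 3 / ln (real r)"
proof -
  show pos: "0 < ln (real r)" using assms by simp
  have "real r ^ 2 * ln (real r) \<le> real r ^ 2 * real r"
    using ln_le_minus_one[of "real r"] assms by (intro mult_left_mono) auto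
  then show "real r ^ 2 \<le> real r ^ 3 / ln (real r)"
    using pos by (simp add: pos_le_divide_eq power3_eq_cube power2_eq_square)
qed

text \<open>\<open>x\<close> stands for \<open>r\<close>, \<open>2 * x powr (11/10)\<close> bounds
  the sample size, and \<open>ln x / (1280 * x ^ 3)\<close> bounds \<open>\<rho>\<close>. The
  exponent 11/10 must exceed 21/20 for the strict inequality and stay below 9/8 for the term with
  the eighth power to vanish.\<close>

lemma eventually_sample_bounds:
  "\<forall>\<^sub>F x :: real in at_top.
     (2 * x powr (11/10)) ^ 3 * (ln x / (1280 * x ^ 3)) / x
       + 40 * (2 * x powr (11/10)) ^ 5 * (ln x / (1280 * x ^ 3)) ^ 2
       + 16 * (2 * x powr (11/10)) ^ 8 * (ln x / (1280 * x ^ 3)) ^ 3 \<le> 1 / 2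
     \<and> 4 * x powr (11/10) \<le> x ^ 3 / ln x
     \<and> 8 * x * x powr (1/20) < x powr (11/10)
     \<and> 3 \<le> x"
  by (intro eventually_conj; real_asymp)

text \<open>Without a rainbow clique the sample size would be at most \<open>8 * r\<close> times an
  exponential factor. The constant 3840 makes \<open>\<rho>\<close> at most
  \<open>ln r / (1280 * r ^ 3)\<close>, which bounds this factor by \<open>r powr (1/20)\<close>,
  too little for a sample of size at least \<open>r powr (11/10)\<close>.\<close>

lemma ex_large_rainbow_clique:
  "\<exists>r0\<ge>3. \<forall>r\<ge>r0. \<forall>(V :: 'a set) \<chi> d. finite V \<longrightarrow> 1 \<le> d \<longrightarrow>
     (\<forall>v\<in>V. \<forall>c. card (color_nbrs \<chi> V v c) \<le> d) \<longrightarrow>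
     3840 * real d * (real r ^ 3 / ln (real r)) \<le> real (card V) \<longrightarrow>
     (\<exists>S\<subseteq>V. card S = r \<and> rainbow_clique \<chi> S)"
proof -
  from eventually_sample_bounds obtain x0 :: real where x0: "\<And>x. x0 \<le> x \<Longrightarrow>
     (2 * x powr (11/10)) ^ 3 * (ln x / (1280 * x ^ 3)) / x
       + 40 * (2 * x powr (11/10)) ^ 5 * (ln x / (1280 * x ^ 3)) ^ 2
       + 16 * (2 * x powr (11/10)) ^ 8 * (ln x / (1280 * x ^ 3)) ^ 3 \<le> 1 / 2
     \<and> 4 * x powr (11/10) \<le> x ^ 3 / ln x
     \<and> 8 * x * x powr (1/20) < x powr (11/10)
     \<and> 3 \<le> x" unfolding eventually_at_top_linorder by blast
  show ?thesis
  proof (intro exI[of _ "max 3 (nat \<lceil>x0\<rceil>)"] conjI allI impI)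
    fix r :: nat and V :: "'a set" and \<chi> and d :: nat
    assume r: "max 3 (nat \<lceil>x0\<rceil>) \<le> r" and V: "finite V" and d: "1 \<le> d"
      and deg: "\<forall>v\<in>V. \<forall>c. card (color_nbrs \<chi> V v c) \<le> d"
      and large: "3840 * real d * (real r ^ 3 / ln (real r)) \<le> real (card V)"
    define n where "n = card V"
    define x where "x = real r"
    define z where "z = x powr (11/10)"
    define \<kappa> where "\<kappa> = nat \<lceil>z\<rceil>"
    define \<rho> where "\<rho> = real (3 * d) / real n"
    define \<sigma> where "\<sigma> = ln x / (1280 * x ^ 3)"
    have r3: "3 \<le> r" using r by simp
    have "x0 \<le> x" using r by (simp add: x_def)
    note x = x0[OF this]
    have small: "(2 * z) ^ 3 * \<sigma> / x + 40 * (2 * z) ^ 5 * \<sigma> ^ 2 + 16 * (2 * z) ^ 8 * \<sigma> ^ 3 \<le> 1 / 2"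
      using x unfolding z_def \<sigma>_def by blast
    have lnx: "ln x > 0" using cube_div_ln_ge(1)[OF r3] by (simp add: x_def)
    have z1: "1 \<le> z" using x unfolding z_def by (intro ge_one_powr_ge_zero) auto
    then have \<kappa>_z: "z \<le> real \<kappa>" "real \<kappa> \<le> 2 * z" "1 \<le> \<kappa>" unfolding \<kappa>_def by linarith+
    have g: "x ^ 3 / ln x > 0" using lnx x by simp
    have dg: "x ^ 3 / ln x \<le> real d * (x ^ 3 / ln x)" using mult_right_mono[of 1 "real d" "x ^ 3 / ln x"] d g by simp
    have n_ge: "3840 * (real d * (x ^ 3 / ln x)) \<le> real n" using large by (simp add: x_def n_def)
    have n\<kappa>: "2 * real \<kappa> \<le> real n"
    proof -
      have "2 * real \<kappa> \<le> 4 * z" using \<kappa>_z by simp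
      also have "\<dots> \<le> x ^ 3 / ln x" using x by (simp add: z_def)
      finally show ?thesis using n_ge dg g by linarith
    qed
    have npos: "real n > 0" using n\<kappa> \<kappa>_z by linarith
    have \<rho>: "0 \<le> \<rho>" "\<rho> \<le> \<sigma>"
    proof -
      show "0 \<le> \<rho>" by (simp add: \<rho>_def)
      have "3 * real d * (1280 * x ^ 3) \<le> ln x * real n"
        using n_ge lnx by (simp add: pos_divide_le_eq field_simps)
      then show "\<rho> \<le> \<sigma>" using npos lnx x by (simp add: \<rho>_def \<sigma>_def divide_simps mult_ac)
    qed
    show "\<exists>S\<subseteq>V. card S = r \<and> rainbow_clique \<chi> S"
    proof (rule ccontr)
      assume no: "\<not> (\<exists>S\<subseteq>V. card S = r \<and> rainbow_clique \<chi> S)"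
      have "real \<kappa> ^ 3 * \<rho> / real r + 40 * real \<kappa> ^ 5 * \<rho> ^ 2 + 16 * real \<kappa> ^ 8 * \<rho> ^ 3
          \<le> (2 * z) ^ 3 * \<sigma> / x + 40 * (2 * z) ^ 5 * \<sigma> ^ 2 + 16 * (2 * z) ^ 8 * \<sigma> ^ 3"
        unfolding x_def using \<rho> \<kappa>_z
        by (intro add_mono divide_right_mono mult_mono power_mono mult_left_mono) auto
      also note small
      finally have "real \<kappa> \<le> 8 * x * exp (ln 4 * (48 * real d * x ^ 3 / real (n - \<kappa> + 1)))"
        unfolding x_def \<rho>_def using V deg no n\<kappa> \<kappa>_z(3) r3
        by (intro sample_size_le_of_no_rainbow_clique[where V = V and \<chi> = \<chi>]) (auto simp: n_def)
      also have "\<dots> \<le> 8 * x * x powr (1/20)"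
      proof (intro mult_left_mono)
        \<comment> \<open>\<open>2 * \<kappa> \<le> n\<close> gives \<open>n / 2\<close> as a lower
          bound for the denominator. The exponent becomes at most \<open>32 / 1280 * ln x\<close>,
          and \<open>ln 4 \<le> 2\<close> leaves \<open>ln x / 20\<close>.\<close>
        have "48 * real d * x ^ 3 / real (n - \<kappa> + 1) \<le> 48 * real d * x ^ 3 / (real n / 2)"
          using n\<kappa> npos x by (intro divide_left_mono) auto
        also have "\<dots> = 32 * x ^ 3 * \<rho>" by (simp add: \<rho>_def)
        also have "\<dots> \<le> 32 * x ^ 3 * \<sigma>" using \<rho> x by (intro mult_left_mono) auto
        also have "\<dots> = ln x / 40" using x by (simp add: \<sigma>_def)
        finally have "ln 4 * (48 * real d * x ^ 3 / real (n - \<kappa> + 1)) \<le> 2 * (ln x / 40)"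
        proof (intro mult_mono)
          have "ln (4::real) = 2 * ln 2" using ln_realpow[of 2 2] by simp
          then show "ln (4::real) \<le> 2" using ln_2_less_1 by simp
        qed (use x in auto)
        then show "exp (ln 4 * (48 * real d * x ^ 3 / real (n - \<kappa> + 1))) \<le> x powr (1/20)"
          using x by (simp add: powr_def)
      qed (use x in auto)
      also have "\<dots> < z" using x by (simp add: z_def)
      finally show False using \<kappa>_z by simp
    qed
  qed simp
qed

text \<open>If no star is large, then the degree bound \<open>d\<close>, the rounded-down quotient,
  is small enough for a rainbow clique. Values of \<open>r\<close> below the threshold
  \<open>r0\<close> are handled by finding a rainbow clique on \<open>r0\<close> vertices, for which
  \<open>K\<close> contains the factor \<open>g r0\<close>.\<close>

lemma ex_rainbow_clique_or_large_star:
  "\<exists>K::real. 1 \<le> K \<and> (\<forall>r\<ge>3. \<forall>(V :: 'a set) \<chi>. finite V \<longrightarrow>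
     K * (real r ^ 3 / ln (real r)) \<le> real (card V) \<longrightarrow>
     (\<exists>S\<subseteq>V. card S = r \<and> rainbow_clique \<chi> S) \<or>
     (\<exists>v\<in>V. \<exists>c. real (card V) / (K * (real r ^ 3 / ln (real r))) < real (card (color_nbrs \<chi> V v c))))"
proof -
  define g where "g r = real r ^ 3 / ln (real r)" for r :: nat
  have g1: "1 \<le> g r" if "3 \<le> r" for r
  proof -
    have "1 \<le> real r ^ 2" using that by (intro one_le_power) simp
    then show ?thesis using cube_div_ln_ge(2)[OF that] unfolding g_def by linarith
  qed
  obtain r0 where r0: "3 \<le> r0" and rainbow: "\<And>r (V :: 'a set) \<chi> d. r0 \<le> r \<Longrightarrow> finite V \<Longrightarrow> 1 \<le> d \<Longrightarrow>
     (\<forall>v\<in>V. \<forall>c. card (color_nbrs \<chi> V v c) \<le> d) \<Longrightarrow>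
     3840 * real d * g r \<le> real (card V) \<Longrightarrow> (\<exists>S\<subseteq>V. card S = r \<and> rainbow_clique \<chi> S)"
    using ex_large_rainbow_clique[where 'a = 'a] unfolding g_def by metis
  define K where "K = 3840 * g r0"
  have K: "3840 \<le> K" using g1[OF r0] by (simp add: K_def)
  show ?thesis
  proof (fold g_def, intro exI[of _ K] conjI allI impI)
    show "1 \<le> K" using K by simp
    fix r :: nat and V :: "'a set" and \<chi>
    assume r: "3 \<le> r" and V: "finite V" and large: "K * g r \<le> real (card V)"
    define q where "q = real (card V) / (K * g r)"
    have Kg: "0 < K * g r" using K g1[OF r] by simp
    \<comment> \<open>With the floor, a color degree above \<open>d\<close> is at least
      \<open>d + 1\<close> and hence strictly above the real number \<open>q\<close>.\<close>
    define d where "d = nat \<lfloor>q\<rfloor>"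
    have "1 \<le> q" using large Kg by (simp add: q_def)
    then have d: "1 \<le> d" "real d \<le> q" "q < real d + 1" unfolding d_def by linarith+
    show "(\<exists>S\<subseteq>V. card S = r \<and> rainbow_clique \<chi> S) \<or>
        (\<exists>v\<in>V. \<exists>c. real (card V) / (K * g r) < real (card (color_nbrs \<chi> V v c)))"
    proof (cases "\<forall>v\<in>V. \<forall>c. card (color_nbrs \<chi> V v c) \<le> d")
      case True
      have "real d * (K * g r) \<le> real (card V)"
        using d(2) Kg by (simp add: q_def pos_le_divide_eq)
      moreover have "3840 * g (max r r0) \<le> K * g r"
      proof (cases "r0 \<le> r")
        case True
        then show ?thesis using K g1[OF r] by (simp add: max_def mult_right_mono)
      next
        case False
        then have "3840 * g (max r r0) = K * 1" by (simp add: K_def max_def)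
        also have "\<dots> \<le> K * g r" using K g1[OF r] by (intro mult_left_mono) auto
        finally show ?thesis .
      qed
      ultimately have "3840 * real d * g (max r r0) \<le> real (card V)"
        using mult_left_mono[of "3840 * g (max r r0)" "K * g r" "real d"] by (simp add: mult_ac)
      then obtain S where S: "S \<subseteq> V" "card S = max r r0" "rainbow_clique \<chi> S"
        using rainbow[of "max r r0" V d \<chi>] V d(1) True by auto
      then show ?thesis using rainbow_clique_subset_card[of \<chi> S V r] by auto
    next
      case False
      then obtain v c where "v \<in> V" "d < card (color_nbrs \<chi> V v c)" by (auto simp: not_le)
      then have "real d + 1 \<le> real (card (color_nbrs \<chi> V v c))" by simp
      then show ?thesis using d(3) \<open>v \<in> V\<close> unfolding q_def by (meson less_le_trans)
    qed
  qed
qed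

section \<open>Lexical cliques and the three bounds\<close>

text \<open>Put \<open>v\<close> first in the ordering: its edges share the color \<open>c\<close>,
  which does not occur inside \<open>T\<close>.\<close>

lemma lexical_clique_cone:
  assumes T: "lexical_clique \<chi> T" "finite T" "v \<notin> T"
    and c: "\<And>w. w \<in> T \<Longrightarrow> \<chi> {v, w} = c" "\<And>e. e \<in> [T]\<^bsup>2\<^esup> \<Longrightarrow> \<chi> e \<noteq> c"
  shows "lexical_clique \<chi> (insert v T)"
proof -
  obtain u where u: "bij_betw u {1..card T} T" and lex: "\<forall>i\<in>{1..card T}. \<forall>j\<in>{1..card T}.
      \<forall>i'\<in>{1..card T}. \<forall>j'\<in>{1..card T}. i < j \<and> i' < j' \<longrightarrow> (\<chi> {u i, u j} = \<chi> {u i', u j'} \<longleftrightarrow> i = i')"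
    using T(1) unfolding lexical_clique_def by (elim exE conjE)
  \<comment> \<open>The ordering of \<open>T\<close> moves up by one position to make room for
    \<open>v\<close> at position 1.\<close>
  define w where "w i = (if i = 1 then v else u (i - 1))" for i
  have uT: "u i \<in> T" if "i \<in> {1..card T}" for i using u that bij_betwE by blast
  have pred: "u (i - 1) \<in> T" if "1 < i" "i \<le> Suc (card T)" for i
    by (rule uT; unfold atLeastAtMost_iff; use that in linarith)
  have card: "card (insert v T) = Suc (card T)" using T by simp
  have "bij_betw (\<lambda>i. i - 1) {2..Suc (card T)} {1..card T}"
    by (rule bij_betw_byWitness[where f' = Suc]) (auto simp: image_subset_iff)
  from bij_betw_trans[OF this u] have "bij_betw (\<lambda>i. u (i - 1)) {2..Suc (card T)} T"
    by (simp add: comp_def)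
  then have "bij_betw w {2..Suc (card T)} T" by (subst bij_betw_cong[of _ w]) (auto simp: w_def)
  then have "bij_betw w (insert 1 {2..Suc (card T)}) (insert (w 1) T)"
    using T(3) by (subst notIn_Un_bij_betw3[of 1, unfolded Un_insert_right Un_empty_right, symmetric]) (auto simp: w_def)
  moreover have "insert 1 {2..Suc (card T)} = {1..Suc (card T)}" by auto
  ultimately have bij: "bij_betw w {1..card (insert v T)} (insert v T)" by (simp add: card w_def)
  have first: "\<chi> {w 1, w j} = c" if "1 < j" "j \<le> Suc (card T)" for j
    using c(1)[OF pred] that by (simp add: w_def)
  have later: "\<chi> {w i, w j} \<noteq> c" if "1 < i" "i < j" "j \<le> Suc (card T)" for i j
  proof -
    have "u (i - 1) \<in> T" "u (j - 1) \<in> T" using that by (intro pred; linarith)+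
    moreover have "u (i - 1) \<noteq> u (j - 1)"
    proof
      assume "u (i - 1) = u (j - 1)"
      then have "i - 1 = j - 1"
        by (rule inj_onD[OF bij_betw_imp_inj_on[OF u]]; unfold atLeastAtMost_iff; use that in linarith)
      then show False using that by linarith
    qed
    ultimately show ?thesis using c(2)[of "{u (i - 1), u (j - 1)}"] that by (simp add: w_def)
  qed
  have "\<chi> {w i, w j} = \<chi> {w i', w j'} \<longleftrightarrow> i = i'"
    if ij: "1 \<le> i" "1 \<le> i'" "i < j" "i' < j'" "j \<le> Suc (card T)" "j' \<le> Suc (card T)" for i j i' j'
  proof -
    consider "i = 1" "i' = 1" | "i = 1" "1 < i'" | "1 < i" "i' = 1" | "1 < i" "1 < i'"
      using ij(1,2) by linarith
    then show ?thesis
    proof cases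
      case 1
      then show ?thesis using first ij by simp
    next
      case 2
      then show ?thesis using first[of j] later[of i' j'] ij by auto
    next
      case 3
      then show ?thesis using first[of j'] later[of i j] ij by auto
    next
      case 4
      have "\<chi> {u (i - 1), u (j - 1)} = \<chi> {u (i' - 1), u (j' - 1)} \<longleftrightarrow> i - 1 = i' - 1"
        by (rule lex[rule_format]; (unfold atLeastAtMost_iff)?; use 4 ij in linarith)
      then show ?thesis using 4 ij by (simp add: w_def) linarith
    qed
  qed
  then show ?thesis unfolding lexical_clique_def using bij card by (intro exI[of _ w]) auto
qed

lemma lexical_clique_singleton: "lexical_clique \<chi> {a}"
  unfolding lexical_clique_def by (intro exI[of _ "\<lambda>_. a"]) (auto simp: bij_betw_def)

lemma lexical_clique_pair: "a \<noteq> b \<Longrightarrow> lexical_clique \<chi> {a, b}"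
  by (rule lexical_clique_cone[OF lexical_clique_singleton, where c = "\<chi> {a, b}"]) (auto simp: nsets_2_eq)

lemma lexical_clique_triangle:
  assumes "a \<noteq> b" "a \<noteq> c" "b \<noteq> c" "\<chi> {a, b} = \<chi> {a, c}" "\<chi> {b, c} \<noteq> \<chi> {a, b}"
  shows "lexical_clique \<chi> {a, b, c}"
  using assms by (intro lexical_clique_cone[OF lexical_clique_pair, where c = "\<chi> {a, b}"]) auto

lemma monochromatic_cliqueI:
  assumes "\<And>a b. a \<in> S \<Longrightarrow> b \<in> S \<Longrightarrow> a \<noteq> b \<Longrightarrow> \<chi> {a, b} = c"
  shows "monochromatic_clique \<chi> S"
proof -
  have "\<chi> e = c" if "e \<in> [S]\<^bsup>2\<^esup>" for e using that assms by (auto simp: nsets_2_eq)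
  then show ?thesis by (simp add: monochromatic_clique_def)
qed

text \<open>The centre of a monochromatic star and two leaves joined in another color form a lexical
  triangle. Without one, all edges among the leaves have the color of the star, and there are at
  least \<open>m\<close> leaves.\<close>

lemma unavoidable_lexical_triangle:
  fixes V :: "'a set" and g :: real
  assumes V: "finite V" and m: "1 \<le> m" and g: "0 < g" and large: "real m * g \<le> real (card V)"
    and star: "g \<le> real (card V) \<Longrightarrow> (\<exists>S\<subseteq>V. card S = r \<and> rainbow_clique \<chi> S) \<or>
      (\<exists>v\<in>V. \<exists>c. real (card V) / g < real (card (color_nbrs \<chi> V v c)))"
  shows "(\<exists>S\<subseteq>V. card S = m \<and> monochromatic_clique \<chi> S) \<or>
         (\<exists>S\<subseteq>V. card S = 3 \<and> lexical_clique \<chi> S) \<or>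
         (\<exists>S\<subseteq>V. card S = r \<and> rainbow_clique \<chi> S)"
proof (rule ccontr)
  assume neg: "\<not> ?thesis"
  then have no_mono: "\<not> (\<exists>S\<subseteq>V. card S = m \<and> monochromatic_clique \<chi> S)"
    and no_lex: "\<not> (\<exists>S\<subseteq>V. card S = 3 \<and> lexical_clique \<chi> S)"
    and no_rainbow: "\<not> (\<exists>S\<subseteq>V. card S = r \<and> rainbow_clique \<chi> S)" by simp_all
  have "g \<le> real m * g" using m g by simp
  then have "g \<le> real (card V)" using large by linarith
  from star[OF this] no_rainbow obtain v c where v: "v \<in> V" and big: "real (card V) / g < real (card (color_nbrs \<chi> V v c))"
    by blast
  have "real m \<le> real (card V) / g" using large g by (simp add: pos_le_divide_eq)
  then have "m \<le> card (color_nbrs \<chi> V v c)" using big by linarith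
  then obtain S where S: "S \<subseteq> color_nbrs \<chi> V v c" "card S = m" by (meson obtain_subset_with_card_n)
  have "monochromatic_clique \<chi> S"
  proof (rule monochromatic_cliqueI[of _ _ c])
    fix a b assume ab: "a \<in> S" "b \<in> S" "a \<noteq> b"
    then have vab: "a \<in> V" "b \<in> V" "v \<noteq> a" "v \<noteq> b" "\<chi> {v, a} = c" "\<chi> {v, b} = c"
      using S by (auto simp: color_nbrs_def)
    show "\<chi> {a, b} = c"
    proof (rule ccontr)
      assume "\<chi> {a, b} \<noteq> c"
      then have "lexical_clique \<chi> {v, a, b}" using vab ab by (intro lexical_clique_triangle) auto
      moreover have "{v, a, b} \<subseteq> V" "card {v, a, b} = 3" using vab ab v by auto
      ultimately show False using no_lex by blast
    qed
  qed
  moreover have "S \<subseteq> V" using S by (auto simp: color_nbrs_def)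
  ultimately show False using no_mono S(2) by blast
qed

text \<open>Each step passes to the leaves of a large star. Without a monochromatic triangle the
  color of the star does not occur among its leaves, so the centre can be put in front of a lexical
  clique found there.\<close>

lemma unavoidable_monochromatic_triangle:
  fixes V :: "'a set" and g :: real
  assumes g: "1 \<le> g"
    and star: "\<And>V :: 'a set. finite V \<Longrightarrow> g \<le> real (card V) \<Longrightarrow> (\<exists>S\<subseteq>V. card S = r \<and> rainbow_clique \<chi> S) \<or>
      (\<exists>v\<in>V. \<exists>c. real (card V) / g < real (card (color_nbrs \<chi> V v c)))"
    and V: "finite V" "g ^ j < real (card V)"
  shows "(\<exists>S\<subseteq>V. card S = 3 \<and> monochromatic_clique \<chi> S) \<or>
         (\<exists>S\<subseteq>V. card S = j + 2 \<and> lexical_clique \<chi> S) \<or>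
         (\<exists>S\<subseteq>V. card S = r \<and> rainbow_clique \<chi> S)"
  using V
proof (induction j arbitrary: V)
  case 0
  \<comment> \<open>The strict bound \<open>g ^ 0 < card V\<close> provides two vertices, and every
    pair is lexical.\<close>
  then have "2 \<le> card V" by simp
  then obtain S where S: "S \<subseteq> V" "card S = 2" by (meson obtain_subset_with_card_n)
  then have "lexical_clique \<chi> S" using lexical_clique_pair by (auto simp: card_2_iff)
  then show ?case using S by auto
next
  case (Suc j)
  show ?case
  proof (rule ccontr)
    assume neg: "\<not> ?thesis"
    then have no_mono: "\<not> (\<exists>S\<subseteq>V. card S = 3 \<and> monochromatic_clique \<chi> S)"
      and no_lex: "\<not> (\<exists>S\<subseteq>V. card S = Suc j + 2 \<and> lexical_clique \<chi> S)"
      and no_rainbow: "\<not> (\<exists>S\<subseteq>V. card S = r \<and> rainbow_clique \<chi> S)" by simp_all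
    have "g \<le> g ^ Suc j" using g by (simp add: mult_le_cancel_left1 one_le_power)
    then have "g \<le> real (card V)" using Suc.prems by linarith
    from star[OF Suc.prems(1) this] no_rainbow
    obtain v c where v: "v \<in> V" and big: "real (card V) / g < real (card (color_nbrs \<chi> V v c))"
      by blast
    define N where "N = color_nbrs \<chi> V v c"
    have N: "N \<subseteq> V" "v \<notin> N" "\<And>w. w \<in> N \<Longrightarrow> \<chi> {v, w} = c" by (auto simp: N_def color_nbrs_def)
    have finN: "finite N" using N(1) Suc.prems(1) finite_subset by blast
    have "g ^ j < real (card V) / g"
      using Suc.prems(2) g by (simp add: pos_less_divide_eq mult.commute)
    then have "g ^ j < real (card N)" using big by (simp add: N_def)
    note Suc.IH[OF finN this]
    moreover have "\<not> (\<exists>S\<subseteq>N. card S = 3 \<and> monochromatic_clique \<chi> S)"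
      using no_mono order_trans[OF _ N(1)] by blast
    moreover have "\<not> (\<exists>S\<subseteq>N. card S = r \<and> rainbow_clique \<chi> S)"
      using no_rainbow order_trans[OF _ N(1)] by blast
    ultimately obtain T where T: "T \<subseteq> N" "card T = j + 2" "lexical_clique \<chi> T" by blast
    have finT: "finite T" using T(1) finN finite_subset by blast
    have "\<chi> e \<noteq> c" if e: "e \<in> [T]\<^bsup>2\<^esup>" for e
    proof
      assume "\<chi> e = c"
      from e obtain a b where ab: "e = {a, b}" "a \<in> T" "b \<in> T" "a \<noteq> b" by (auto elim!: nsets2_E)
      then have vab: "a \<in> N" "b \<in> N" "v \<noteq> a" "v \<noteq> b" using T N by auto
      then have "monochromatic_clique \<chi> {v, a, b}"
        using \<open>\<chi> e = c\<close> ab N(3) by (intro monochromatic_cliqueI[of _ _ c]) (auto simp: insert_commute)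
      moreover have "{v, a, b} \<subseteq> V" "card {v, a, b} = 3" using vab ab v N(1) by auto
      ultimately show False using no_mono by blast
    qed
    then have "lexical_clique \<chi> (insert v T)"
      using T N by (intro lexical_clique_cone[of _ _ _ c] finT) auto
    moreover have "v \<notin> T" using T N by blast
    then have "insert v T \<subseteq> V" "card (insert v T) = Suc j + 2" using T N v finT by auto
    ultimately show False using no_lex by blast
  qed
qed

section \<open>Excluding cliques on four vertices\<close>

lemma color_nbrs_commute: "w \<in> color_nbrs \<chi> V v c \<longleftrightarrow> w \<in> V \<and> w \<noteq> v \<and> \<chi> {w, v} = c"
  by (auto simp: color_nbrs_def insert_commute)

lemma card_3_obtain:
  assumes "3 \<le> card B"
  obtains x y z where "x \<in> B" "y \<in> B" "z \<in> B" "x \<noteq> y" "x \<noteq> z" "y \<noteq> z"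
proof -
  obtain S where "S \<subseteq> B" "card S = 3" using obtain_subset_with_card_n[OF assms] by blast
  then show thesis using that by (auto simp: card_3_iff)
qed

text \<open>The Ramsey bound for triangles on six vertices: some vertex \<open>b\<close> has three
  neighbors in one color, and either an edge between them has that color or they form a triangle in
  the other.\<close>

lemma two_color_triangle:
  fixes \<chi> :: "'a set \<Rightarrow> nat"
  assumes B: "finite B" "6 \<le> card B"
    and two: "\<forall>x\<in>B. \<forall>y\<in>B. x \<noteq> y \<longrightarrow> \<chi> {x, y} = c \<or> \<chi> {x, y} = c'"
  obtains x y z k where "x \<in> B" "y \<in> B" "z \<in> B" "x \<noteq> y" "x \<noteq> z" "y \<noteq> z" "k = c \<or> k = c'"
    "\<chi> {x, y} = k" "\<chi> {x, z} = k" "\<chi> {y, z} = k"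
proof -
  obtain b where b: "b \<in> B" using B by fastforce
  have "B - {b} \<subseteq> color_nbrs \<chi> B b c \<union> color_nbrs \<chi> B b c'" using two b by (auto simp: color_nbrs_def)
  then have "card (B - {b}) \<le> card (color_nbrs \<chi> B b c \<union> color_nbrs \<chi> B b c')"
    using B by (intro card_mono) (auto simp: color_nbrs_def)
  also have "\<dots> \<le> card (color_nbrs \<chi> B b c) + card (color_nbrs \<chi> B b c')" by (rule card_Un_le)
  finally have "card (B - {b}) \<le> card (color_nbrs \<chi> B b c) + card (color_nbrs \<chi> B b c')" .
  moreover have "5 \<le> card (B - {b})" using B b by simp
  ultimately have "3 \<le> card (color_nbrs \<chi> B b c) \<or> 3 \<le> card (color_nbrs \<chi> B b c')" by linarith
  then obtain k k' where k: "{k, k'} = {c, c'}" and big: "3 \<le> card (color_nbrs \<chi> B b k)" by blast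
  obtain x y z where xyz: "x \<in> color_nbrs \<chi> B b k" "y \<in> color_nbrs \<chi> B b k" "z \<in> color_nbrs \<chi> B b k"
    "x \<noteq> y" "x \<noteq> z" "y \<noteq> z" using card_3_obtain[OF big] by blast
  have mem: "w \<in> B" "b \<noteq> w" "\<chi> {b, w} = k" if "w \<in> color_nbrs \<chi> B b k" for w
    using that by (auto simp: color_nbrs_def)
  have kc: "k = c \<or> k = c'" "k' = c \<or> k' = c'" using k by auto
  have col: "\<chi> {u, w} = k \<or> \<chi> {u, w} = k'" if "u \<in> B" "w \<in> B" "u \<noteq> w" for u w
    using two that k by (metis insert_iff singletonD)
  consider "\<chi> {x, y} = k" | "\<chi> {x, z} = k" | "\<chi> {y, z} = k"
    | "\<chi> {x, y} = k'" "\<chi> {x, z} = k'" "\<chi> {y, z} = k'"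
    using col[of x y] col[of x z] col[of y z] mem(1) xyz by blast
  then show thesis
  proof cases
    case 1
    then show thesis using that[of b x y k] b mem xyz kc(1) by blast
  next
    case 2
    then show thesis using that[of b x z k] b mem xyz kc(1) by blast
  next
    case 3
    then show thesis using that[of b y z k] b mem xyz kc(1) by blast
  next
    case 4
    then show thesis using that[of x y z k'] mem(1) xyz kc(2) by blast
  qed
qed

text \<open>A large star has a leaf set \<open>N\<close> of more than \<open>10 * g * r\<close>
  vertices. Inside \<open>N\<close> its color \<open>c\<close> has degree at most
  \<open>4 * g\<close> and every other color at most 5, so that a largest rainbow set avoiding
  \<open>c\<close> can only block fewer than \<open>r\<close> vertices' worth of neighbors, too few
  to cover \<open>N\<close>.\<close>

lemma unavoidable_4_4:
  fixes V :: "'a set" and g :: real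
  assumes r: "1 \<le> r" and g: "real r ^ 2 \<le> g"
    and star: "\<And>V :: 'a set. finite V \<Longrightarrow> g \<le> real (card V) \<Longrightarrow> (\<exists>S\<subseteq>V. card S = r \<and> rainbow_clique \<chi> S) \<or>
      (\<exists>v\<in>V. \<exists>c. real (card V) / g < real (card (color_nbrs \<chi> V v c)))"
    and V: "finite V" and large: "10 * g ^ 2 * real r \<le> real (card V)"
  shows "(\<exists>S\<subseteq>V. card S = 4 \<and> monochromatic_clique \<chi> S) \<or>
         (\<exists>S\<subseteq>V. card S = 4 \<and> lexical_clique \<chi> S) \<or>
         (\<exists>S\<subseteq>V. card S = r \<and> rainbow_clique \<chi> S)"
proof (rule ccontr)
  assume neg: "\<not> ?thesis"
  then have no_mono: "\<not> (\<exists>S\<subseteq>V. card S = 4 \<and> monochromatic_clique \<chi> S)"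
    and no_lex: "\<not> (\<exists>S\<subseteq>V. card S = 4 \<and> lexical_clique \<chi> S)"
    and no_rainbow: "\<not> (\<exists>S\<subseteq>V. card S = r \<and> rainbow_clique \<chi> S)" by simp_all
  have r1: "1 \<le> real r" using r by simp
  then have "1 \<le> real r ^ 2" by (rule one_le_power)
  then have g1: "1 \<le> g" using g by linarith
  have "g * 1 \<le> g * (10 * g * real r)"
    using mult_mono[of 1 "10 * g" 1 "real r"] g1 r1 by (intro mult_left_mono) auto
  then have "g \<le> real (card V)" using large by (simp add: power2_eq_square mult_ac)
  from star[OF V this] no_rainbow
  obtain v c where v: "v \<in> V" and big: "real (card V) / g < real (card (color_nbrs \<chi> V v c))" by blast
  define N where "N = color_nbrs \<chi> V v c"
  have N: "N \<subseteq> V" "v \<notin> N" "\<And>w. w \<in> N \<Longrightarrow> \<chi> {v, w} = c" by (auto simp: N_def color_nbrs_def)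
  have finN: "finite N" using N(1) V finite_subset by blast
  have "10 * g * real r \<le> real (card V) / g"
    using large g1 by (simp add: pos_le_divide_eq power2_eq_square mult_ac)
  then have N_big: "10 * g * real r < real (card N)" using big by (simp add: N_def)
  \<comment> \<open>The centre \<open>v\<close> in front of such a triangle would give a lexical
    clique on four vertices.\<close>
  have no_lex3: False if "T \<subseteq> N" "card T = 3" "lexical_clique \<chi> T" "\<And>e. e \<in> [T]\<^bsup>2\<^esup> \<Longrightarrow> \<chi> e \<noteq> c" for T
  proof -
    have finT: "finite T" and vT: "v \<notin> T" using that(1) N(2) finN finite_subset by blast+
    have "lexical_clique \<chi> (insert v T)"
      using that N(3) by (intro lexical_clique_cone[of _ _ _ c] finT vT) auto
    moreover have "insert v T \<subseteq> V" "card (insert v T) = 4" using that(1,2) N(1) v finT vT by auto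
    ultimately show False using no_lex by blast
  qed
  have no_lex_triangle: "\<chi> {y, z} = c \<or> \<chi> {y, z} = \<chi> {x, y}"
    if t: "x \<in> N" "y \<in> N" "z \<in> N" "x \<noteq> y" "x \<noteq> z" "y \<noteq> z" "\<chi> {x, y} = \<chi> {x, z}" "\<chi> {x, y} \<noteq> c" for x y z
  proof (rule ccontr)
    assume ne: "\<not> ?thesis"
    have "lexical_clique \<chi> {x, y, z}" using t ne by (intro lexical_clique_triangle) auto
    moreover have "\<chi> e \<noteq> c" if "e \<in> [{x, y, z}]\<^bsup>2\<^esup>" for e
      using that t ne by (auto simp: nsets_2_eq insert_commute)
    ultimately show False using no_lex3[of "{x, y, z}"] t by simp
  qed
  have no_mono4: False
    if t: "u \<in> V" "x \<in> V" "y \<in> V" "z \<in> V" "u \<noteq> x" "u \<noteq> y" "u \<noteq> z" "x \<noteq> y" "x \<noteq> z" "y \<noteq> z"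
      "\<chi> {u, x} = k" "\<chi> {u, y} = k" "\<chi> {u, z} = k" "\<chi> {x, y} = k" "\<chi> {x, z} = k" "\<chi> {y, z} = k" for u x y z k
  proof -
    have "monochromatic_clique \<chi> {u, x, y, z}"
      using t by (intro monochromatic_cliqueI[of _ _ k]) (auto simp: insert_commute)
    moreover have "{u, x, y, z} \<subseteq> V" "card {u, x, y, z} = 4" using t by auto
    ultimately show False using no_mono by blast
  qed
  have vN: "v \<noteq> w" if "w \<in> N" for w using that N(2) by auto
  have NV: "w \<in> V" if "w \<in> N" for w using that N(1) by auto
  \<comment> \<open>Otherwise there is a lexical triangle among the neighbors of \<open>u\<close> in
    color \<open>c\<close>. If it avoids \<open>c\<close>, then \<open>v\<close> extends it to a
    lexical clique; an edge of color \<open>c\<close> in it forms a monochromatic clique with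
    \<open>u\<close> and \<open>v\<close>.\<close>
  have deg_c: "real (card (color_nbrs \<chi> N u c)) \<le> 4 * g" if u: "u \<in> N" for u
  proof (rule ccontr)
    assume "\<not> ?thesis"
    then have "real 4 * g \<le> real (card (color_nbrs \<chi> N u c))" by simp
    moreover define Q where "Q = color_nbrs \<chi> N u c"
    ultimately have Q_big: "real 4 * g \<le> real (card Q)" by simp
    have Q: "w \<in> N" "u \<noteq> w" "\<chi> {u, w} = c" if "w \<in> Q" for w using that by (auto simp: Q_def color_nbrs_def)
    have QN: "Q \<subseteq> N" using Q by auto
    then have QV: "Q \<subseteq> V" using N(1) by auto
    have finQ: "finite Q" using QN finN finite_subset by blast
    have "(\<exists>S\<subseteq>Q. card S = 4 \<and> monochromatic_clique \<chi> S) \<or>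
         (\<exists>S\<subseteq>Q. card S = 3 \<and> lexical_clique \<chi> S) \<or>
         (\<exists>S\<subseteq>Q. card S = r \<and> rainbow_clique \<chi> S)"
      using g1 by (intro unavoidable_lexical_triangle[OF finQ _ _ Q_big] star finQ) auto
    moreover have "\<not> (\<exists>S\<subseteq>Q. card S = 4 \<and> monochromatic_clique \<chi> S)"
      using no_mono order_trans[OF _ QV] by blast
    moreover have "\<not> (\<exists>S\<subseteq>Q. card S = r \<and> rainbow_clique \<chi> S)"
      using no_rainbow order_trans[OF _ QV] by blast
    ultimately obtain T where T: "T \<subseteq> Q" "card T = 3" "lexical_clique \<chi> T" by blast
    have "\<chi> e \<noteq> c" if e: "e \<in> [T]\<^bsup>2\<^esup>" for e
    proof
      assume ec: "\<chi> e = c"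
      from e obtain a b where ab: "e = {a, b}" "a \<in> T" "b \<in> T" "a \<noteq> b" by (auto elim!: nsets2_E)
      then have abQ: "a \<in> Q" "b \<in> Q" using T by auto
      show False
        by (rule no_mono4[of v u a b c])
          (use v u ab ec Q[OF abQ(1)] Q[OF abQ(2)] vN NV N(3) in simp_all)
    qed
    then show False using no_lex3[of T] T QN by auto
  qed
  \<comment> \<open>By \<open>no_lex_triangle\<close>, neighbors of \<open>u\<close> in color
    \<open>c'\<close> are joined in \<open>c\<close> or \<open>c'\<close>. Six of them contain a
    monochromatic triangle, which extends to four vertices by \<open>v\<close> if its color is
    \<open>c\<close> and by \<open>u\<close> if it is \<open>c'\<close>.\<close>
  have deg_other: "card (color_nbrs \<chi> N u c') \<le> 5" if u: "u \<in> N" and c': "c' \<noteq> c" for u c'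
  proof (rule ccontr)
    define B where "B = color_nbrs \<chi> N u c'"
    assume "\<not> ?thesis"
    then have B_big: "6 \<le> card B" by (simp add: B_def)
    have B: "w \<in> N" "u \<noteq> w" "\<chi> {u, w} = c'" if "w \<in> B" for w using that by (auto simp: B_def color_nbrs_def)
    have finB: "finite B" using B(1) finN finite_subset[of B N] by blast
    have "\<forall>x\<in>B. \<forall>y\<in>B. x \<noteq> y \<longrightarrow> \<chi> {x, y} = c \<or> \<chi> {x, y} = c'"
    proof (intro ballI impI)
      fix x y assume xy: "x \<in> B" "y \<in> B" "x \<noteq> y"
      show "\<chi> {x, y} = c \<or> \<chi> {x, y} = c'"
        using no_lex_triangle[of u x y] B[OF xy(1)] B[OF xy(2)] u c' xy(3) by simp
    qed
    from two_color_triangle[OF finB B_big this]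
    obtain x y z k where t: "x \<in> B" "y \<in> B" "z \<in> B" "x \<noteq> y" "x \<noteq> z" "y \<noteq> z" "k = c \<or> k = c'"
      "\<chi> {x, y} = k" "\<chi> {x, z} = k" "\<chi> {y, z} = k" by metis
    note BB = B[OF t(1)] B[OF t(2)] B[OF t(3)]
    show False
    proof (cases "k = c")
      case True
      show False by (rule no_mono4[of v x y z c]) (use True v t BB vN NV N(3) in simp_all)
    next
      case False
      then have "k = c'" using t(7) by simp
      then show False by (intro no_mono4[of u x y z c']) (use u t BB NV in simp_all)
    qed
  qed
  \<comment> \<open>Avoiding \<open>c\<close> keeps the large degree \<open>4 * g\<close> from being
    charged once per edge of \<open>S\<close>: all colors inside \<open>S\<close> then have degree
    at most 5.\<close>
  define F where "F = {S. S \<subseteq> N \<and> rainbow_clique \<chi> S \<and> (\<forall>e\<in>[S]\<^bsup>2\<^esup>. \<chi> e \<noteq> c)}"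
  have "{} \<in> F" by (auto simp: F_def rainbow_clique_def nsets_2_eq)
  then obtain S where S: "S \<in> F" and max: "\<And>S'. S' \<in> F \<Longrightarrow> card S' \<le> card S"
    using ex_has_greatest_nat[of "\<lambda>S. S \<in> F" "{}" card "Suc (card N)"] finN
    by (auto simp: F_def less_Suc_eq_le card_mono)
  have SN: "S \<subseteq> N" and S_rainbow: "rainbow_clique \<chi> S" and S_c: "\<And>e. e \<in> [S]\<^bsup>2\<^esup> \<Longrightarrow> \<chi> e \<noteq> c"
    using S by (auto simp: F_def)
  have finS: "finite S" using SN finN finite_subset by blast
  have S_small: "card S < r"
    using rainbow_clique_subset_card[OF S_rainbow _, of V r] SN N(1) no_rainbow by (meson not_le order_trans)
  define E where "E = [S]\<^bsup>2\<^esup>"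
  have finE: "finite E" using finS by (simp add: E_def finite_imp_finite_nsets)
  have cover: "N \<subseteq> S \<union> (\<Union>a\<in>S. color_nbrs \<chi> N a c) \<union> (\<Union>a\<in>S. \<Union>e\<in>E. color_nbrs \<chi> N a (\<chi> e))"
  proof (rule ccontr)
    assume "\<not> ?thesis"
    then obtain x where x: "x \<in> N" "x \<notin> S" and xc: "\<And>a. a \<in> S \<Longrightarrow> x \<notin> color_nbrs \<chi> N a c"
      and xe: "\<And>a e. a \<in> S \<Longrightarrow> e \<in> E \<Longrightarrow> x \<notin> color_nbrs \<chi> N a (\<chi> e)" by blast
    have xc': "\<chi> {x, a} \<noteq> c" if "a \<in> S" for a
      using xc[OF that] x that by (auto simp: color_nbrs_commute)
    have xe': "\<chi> {x, a} \<noteq> \<chi> e" if "a \<in> S" "e \<in> [S]\<^bsup>2\<^esup>" for a e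
      using xe[of a e] x that by (auto simp: color_nbrs_commute E_def)
    have edge: "e \<in> [S]\<^bsup>2\<^esup> \<or> (\<exists>a\<in>S. e = {x, a})" if "e \<in> [insert x S]\<^bsup>2\<^esup>" for e
      using that by (auto simp: nsets_2_eq insert_commute)
    \<comment> \<open>If two edges from \<open>x\<close> had the same color, then
      \<open>no_lex_triangle\<close> with apex \<open>x\<close> would give \<open>{a, b}\<close>
      that color or \<open>c\<close>; both are excluded by the choice of \<open>x\<close> and
      \<open>S\<close>.\<close>
    have pair: "\<chi> {x, a} \<noteq> \<chi> {x, b}" if ab: "a \<in> S" "b \<in> S" "a \<noteq> b" for a b
    proof
      assume eq: "\<chi> {x, a} = \<chi> {x, b}"
      have abE: "{a, b} \<in> [S]\<^bsup>2\<^esup>" using ab by simp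
      have "\<chi> {a, b} = c \<or> \<chi> {a, b} = \<chi> {x, a}"
        using x ab SN eq xc'[OF ab(1)] by (intro no_lex_triangle) auto
      then show False using S_c[OF abE] xe'[OF ab(1) abE] by auto
    qed
    have "rainbow_clique \<chi> (insert x S)"
      unfolding rainbow_clique_def
    proof (intro ballI impI)
      fix e f assume ef: "e \<in> [insert x S]\<^bsup>2\<^esup>" "f \<in> [insert x S]\<^bsup>2\<^esup>" "e \<noteq> f"
      from edge[OF ef(1)] edge[OF ef(2)] show "\<chi> e \<noteq> \<chi> f"
      proof (elim disjE bexE)
        assume "e \<in> [S]\<^bsup>2\<^esup>" "f \<in> [S]\<^bsup>2\<^esup>"
        then show ?thesis using S_rainbow ef(3) by (auto simp: rainbow_clique_def)
      next
        fix b assume "e \<in> [S]\<^bsup>2\<^esup>" "b \<in> S" "f = {x, b}"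
        then show ?thesis using xe' by metis
      next
        fix a assume "f \<in> [S]\<^bsup>2\<^esup>" "a \<in> S" "e = {x, a}"
        then show ?thesis using xe' by metis
      next
        fix a b assume "a \<in> S" "e = {x, a}" "b \<in> S" "f = {x, b}"
        then show ?thesis using pair ef(3) by metis
      qed
    qed
    moreover have "\<chi> e \<noteq> c" if "e \<in> [insert x S]\<^bsup>2\<^esup>" for e using edge[OF that] S_c xc' by auto
    ultimately have "insert x S \<in> F" using x SN by (auto simp: F_def)
    then show False using max[of "insert x S"] x finS by simp
  qed
  have fin: "finite (color_nbrs \<chi> N a k)" for a k using finN by (simp add: color_nbrs_def)
  have "card N \<le> card (S \<union> (\<Union>a\<in>S. color_nbrs \<chi> N a c) \<union> (\<Union>a\<in>S. \<Union>e\<in>E. color_nbrs \<chi> N a (\<chi> e)))"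
    using cover finS finE fin by (intro card_mono) auto
  also have "\<dots> \<le> card S + card (\<Union>a\<in>S. color_nbrs \<chi> N a c) + card (\<Union>a\<in>S. \<Union>e\<in>E. color_nbrs \<chi> N a (\<chi> e))"
    by (meson add_le_mono1 card_Un_le le_trans)
  also have "card (\<Union>a\<in>S. color_nbrs \<chi> N a c) \<le> (\<Sum>a\<in>S. card (color_nbrs \<chi> N a c))"
    using finS by (rule card_UN_le)
  also have "card (\<Union>a\<in>S. \<Union>e\<in>E. color_nbrs \<chi> N a (\<chi> e)) \<le> card S * (card E * 5)"
  proof -
    have "card (\<Union>a\<in>S. \<Union>e\<in>E. color_nbrs \<chi> N a (\<chi> e)) \<le> (\<Sum>a\<in>S. card (\<Union>e\<in>E. color_nbrs \<chi> N a (\<chi> e)))"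
      using finS by (rule card_UN_le)
    also have "\<dots> \<le> (\<Sum>a\<in>S. \<Sum>e\<in>E. card (color_nbrs \<chi> N a (\<chi> e)))"
      using finE by (intro sum_mono card_UN_le)
    also have "\<dots> \<le> (\<Sum>a\<in>S. \<Sum>e\<in>E. 5)"
      using SN S_c by (intro sum_mono deg_other) (auto simp: E_def)
    finally show ?thesis by simp
  qed
  finally have "real (card N) \<le> real (card S + (\<Sum>a\<in>S. card (color_nbrs \<chi> N a c)) + card S * (card E * 5))"
    by (simp only: of_nat_le_iff add_le_mono)
  \<comment> \<open>The terms count \<open>S\<close> itself, the neighbors in color
    \<open>c\<close>, and those in colors occurring inside \<open>S\<close>. There are at most
    \<open>r ^ 2\<close> of the latter colors, where \<open>r ^ 2 \<le> g\<close> enters.\<close>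
  also have "\<dots> \<le> real r + 4 * g * real r + 5 * (g * real r)"
  proof -
    have s: "real (card S) \<le> real r" using S_small by simp
    have "real (\<Sum>a\<in>S. card (color_nbrs \<chi> N a c)) \<le> (\<Sum>a\<in>S. 4 * g)"
      unfolding of_nat_sum using SN by (intro sum_mono deg_c) auto
    also have "\<dots> \<le> 4 * g * real r" using s g1 by (simp add: mult_right_mono)
    finally have 1: "real (\<Sum>a\<in>S. card (color_nbrs \<chi> N a c)) \<le> 4 * g * real r" .
    have "card E \<le> card S ^ 2"
    proof (cases "2 \<le> card S")
      case True
      then show ?thesis by (simp add: E_def finS binomial_le_pow)
    qed (simp add: E_def finS binomial_eq_0)
    also have "\<dots> \<le> r ^ 2" using S_small by (intro power_mono) auto
    finally have "real (card E) \<le> real r ^ 2" by (simp flip: of_nat_power)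
    then have "real (card E) \<le> g" using g by linarith
    then have "real (card S) * real (card E) \<le> real r * g" using s by (intro mult_mono) auto
    then show ?thesis using 1 s by (simp add: mult_ac)
  qed
  also have "\<dots> \<le> 10 * g * real r" using mult_right_mono[OF g1, of "real r"] by simp
  finally show False using N_big by simp
qed

section \<open>Rounding and constants for the three bounds\<close>

lemma ER_le:
  assumes "er_unavoidable m l r n" shows "ER m l r \<le> n"
  unfolding ER_def using assms by (rule Least_le)

theorem theorem1p4:
  shows "(\<exists>c::real. c > 0 \<and>
            (\<forall>m r :: nat. m \<ge> 3 \<longrightarrow> r \<ge> 3 \<longrightarrow>
               real (ER m 3 r) \<le> c * real m * (real r ^ 3 / ln (real r))))
       \<and> (\<exists>c::real. c > 0 \<and>
            (\<forall>l r :: nat. l \<ge> 3 \<longrightarrow> r \<ge> 3 \<longrightarrow>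
               real (ER 3 l r) \<le> (c * real r ^ 3 / ln (real r)) ^ (l - 2)))
       \<and> (\<exists>c::real. c > 0 \<and>
            (\<forall>r :: nat. r \<ge> 3 \<longrightarrow>
               real (ER 4 4 r) \<le> c * real r ^ 7 / (ln (real r)) ^ 2))"
proof -
  define h where "h r = real r ^ 3 / ln (real r)" for r :: nat
  obtain K :: real where K: "1 \<le> K" and all: "\<forall>r\<ge>3. \<forall>(V :: nat set) \<chi>. finite V \<longrightarrow>
     K * h r \<le> real (card V) \<longrightarrow> (\<exists>S\<subseteq>V. card S = r \<and> rainbow_clique \<chi> S) \<or>
     (\<exists>v\<in>V. \<exists>c. real (card V) / (K * h r) < real (card (color_nbrs \<chi> V v c)))"
    using ex_rainbow_clique_or_large_star[where 'a = nat, folded h_def] by (elim exE conjE)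
  note star = all[rule_format]
  have h_sq: "real r ^ 2 \<le> h r" if "3 \<le> r" for r
    using cube_div_ln_ge(2)[OF that] by (simp add: h_def)
  have h1: "1 \<le> h r" if "3 \<le> r" for r
  proof -
    have "1 \<le> real r ^ 2" using that by (intro one_le_power) simp
    then show ?thesis using h_sq[OF that] by linarith
  qed
  have hK: "h r \<le> K * h r" if "3 \<le> r" for r
    using mult_right_mono[OF K, of "h r"] h1[OF that] by simp
  have "real (ER m 3 r) \<le> (K + 1) * real m * h r" if m: "3 \<le> m" and r: "3 \<le> r" for m r
  proof -
    define n where "n = nat \<lceil>real m * (K * h r)\<rceil>"
    have n: "real m * (K * h r) \<le> real n" unfolding n_def by linarith
    have Kh: "1 \<le> K * h r" using hK[OF r] h1[OF r] by linarith
    have "er_unavoidable m 3 r n"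
      unfolding er_unavoidable_def
      using m r n Kh by (intro allI unavoidable_lexical_triangle[where g = "K * h r"] star) auto
    then have "real (ER m 3 r) \<le> real n" using ER_le by simp
    also have "real n \<le> real m * (K * h r) + 1"
      using m Kh unfolding n_def by simp
    \<comment> \<open>Rounding up costs at most 1, which is paid for by the additional 1 in
      \<open>K + 1\<close>.\<close>
    also have "1 \<le> real m * h r" using mult_mono[of 1 "real m" 1 "h r"] m h1[OF r] by simp
    finally show ?thesis by (simp add: algebra_simps)
  qed
  moreover have "real (ER 3 l r) \<le> (2 * K * h r) ^ (l - 2)" if l: "3 \<le> l" and r: "3 \<le> r" for l r
  proof -
    define j where "j = l - 2"
    have j: "l = j + 2" "1 \<le> j" using l by (auto simp: j_def)
    have Kh: "1 \<le> K * h r" using hK[OF r] h1[OF r] by linarith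
    \<comment> \<open>The floor plus 1 gives the strict inequality required by the induction on
      \<open>j\<close>.\<close>
    define n where "n = Suc (nat \<lfloor>(K * h r) ^ j\<rfloor>)"
    have pow: "1 \<le> (K * h r) ^ j" using Kh by (rule one_le_power)
    have n: "(K * h r) ^ j < real n" "real n \<le> (K * h r) ^ j + 1"
      using pow unfolding n_def by linarith+
    have "er_unavoidable 3 l r n"
      unfolding er_unavoidable_def j(1) using Kh n(1) r
      by (intro allI unavoidable_monochromatic_triangle[where g = "K * h r"] star) auto
    then have "real (ER 3 l r) \<le> real n" using ER_le by simp
    \<comment> \<open>The additive 1 at most doubles the bound, and \<open>2 \<le> 2 ^ j\<close>
      moves this factor inside the power, so that one constant serves all \<open>l\<close>.\<close>
    also have "\<dots> \<le> 2 * (K * h r) ^ j" using n(2) pow by linarith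
    also have "\<dots> \<le> 2 ^ j * (K * h r) ^ j"
      using self_le_power[of "2::real" j] j(2) pow by (intro mult_right_mono) auto
    finally show ?thesis by (simp add: power_mult_distrib j(1) mult_ac)
  qed
  moreover have "real (ER 4 4 r) \<le> 11 * K ^ 2 * (h r ^ 2 * real r)" if r: "3 \<le> r" for r
  proof -
    define n where "n = nat \<lceil>10 * (K * h r) ^ 2 * real r\<rceil>"
    have Kh: "1 \<le> K * h r" using hK[OF r] h1[OF r] by linarith
    have n: "10 * (K * h r) ^ 2 * real r \<le> real n" unfolding n_def by linarith
    have "er_unavoidable 4 4 r n"
      unfolding er_unavoidable_def using r n h_sq[OF r] hK[OF r]
      by (intro allI unavoidable_4_4[where g = "K * h r"] star) auto
    then have "real (ER 4 4 r) \<le> real n" using ER_le by simp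
    also have "real n \<le> 10 * (K * h r) ^ 2 * real r + 1"
      unfolding n_def by simp
    also have "1 \<le> (K * h r) ^ 2 * real r"
      using mult_mono[of 1 "(K * h r) ^ 2" 1 "real r"] one_le_power[OF Kh, of 2] r by simp
    finally show ?thesis by (simp add: power_mult_distrib algebra_simps)
  qed
  moreover have "h r ^ 2 * real r = real r ^ 7 / ln (real r) ^ 2" for r
    by (simp add: h_def power_divide flip: power_mult power_Suc2)
  ultimately show ?thesis
    using K by (intro conjI exI[of _ "K + 1"] exI[of _ "2 * K"] exI[of _ "11 * K ^ 2"])
      (auto simp: h_def)
qed

end
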